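(* Let $G\subseteq\mathbb{C}$ be a domain and let $\lambda_j(z)\,|dz|$, $j\in\mathbb{N}$, be a monotonically increasing sequence of regular conformal metrics with constant curvature $-1$ on $G$ (that is, $\lambda_j(z)\le\lambda_{j+1}(z)$ for all $z\in G$ and all $j$). Then $\lambda(z)\,|dz|$ with $\lambda(z):=\lim_{j\to\infty}\lambda_j(z)$ is a regular conformal metric of constant curvature $-1$ on $G$.
   Context: A regular conformal metric $\lambda(z)\,|dz|$ on a domain $G\subseteq\mathbb{C}$ is given by a function $\lambda:G\to(0,+\infty)$ of class $C^2$. Its curvature is $\kappa_\lambda(z)=-\Delta(\log\lambda)(z)/\lambda(z)^2$, where $\Delta=\partial_x^2+\partial_y^2$. *)

theory Defs
  imports "HOL-Complex_Analysis.Complex_Analysis"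
begin

definition partial_deriv :: "'a::euclidean_space \<Rightarrow> ('a \<Rightarrow> real) \<Rightarrow> 'a \<Rightarrow> real" where
  "partial_deriv b f z = deriv (\<lambda>t. f (z + t *\<^sub>R b)) 0"

(* The class C^k on an open set: all iterated partial derivatives (mixed ones included) of
   order at most k exist and are continuous. For open S only the values of f on S matter. *)
primrec Ck_on :: "nat \<Rightarrow> ('a::euclidean_space \<Rightarrow> real) \<Rightarrow> 'a set \<Rightarrow> bool" where
  "Ck_on 0 f S \<longleftrightarrow> continuous_on S f"
| "Ck_on (Suc k) f S \<longleftrightarrow> continuous_on S f \<and>
     (\<forall>b\<in>Basis. (\<forall>z\<in>S. (\<lambda>t. f (z + t *\<^sub>R b)) differentiable (at 0)) \<and>
                Ck_on k (partial_deriv b f) S)"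

(* On the complex plane, Basis = {1, \<i>}, so this is the sum of the pure second partial
   derivatives in x and y. *)
definition laplacian :: "('a::euclidean_space \<Rightarrow> real) \<Rightarrow> 'a \<Rightarrow> real" where
  "laplacian f z = (\<Sum>b\<in>Basis. partial_deriv b (partial_deriv b f) z)"

(* A metric is represented by its density, as a total function constrained only on G. *)
definition regular_conformal_metric :: "complex set \<Rightarrow> (complex \<Rightarrow> real) \<Rightarrow> bool" where
  "regular_conformal_metric G l \<longleftrightarrow> (\<forall>z\<in>G. l z > 0) \<and> Ck_on 2 l G"

definition curvature :: "(complex \<Rightarrow> real) \<Rightarrow> complex \<Rightarrow> real" where
  "curvature l z = - laplacian (\<lambda>w. ln (l w)) z / (l z)\<^sup>2"

end

theory Submission
  imports Defs
begin

text \<open>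
  Put \<open>u\<^sub>j = ln \<lambda>\<^sub>j\<close>. Curvature \<open>-1\<close> means that \<open>u\<^sub>j\<close> solves Liouville's equation
  \<open>\<Delta>u = exp (2u)\<close>, so three things are needed: the \<open>u\<^sub>j\<close> stay locally bounded, their limit is of
  class \<open>C\<^sup>2\<close>, and second derivatives pass to the limit.

  The upper bound is the Ahlfors lemma: on a disc of radius \<open>r\<close>, the hyperbolic metric of the disc
  dominates every metric of curvature \<open>-1\<close>, so \<open>u \<le> ln (2/r)\<close> at the centre
  (\<open>ahlfors_upper_bound\<close>). The lower bound is \<open>u\<^sub>0\<close>, by monotonicity.

  Regularity uses the complex structure in place of potential theory. Let \<open>g\<close> be the gradient of
  \<open>u\<close>, read as a complex number, and \<open>w = cnj g = 2 \<partial>u/\<partial>z\<close>. A symmetric real-linear map of the plane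
  with trace \<open>T\<close> has the form \<open>h \<mapsto> (T/2) h + c (cnj h)\<close>, so the Hessian of a solution is determined by
  \<open>exp (2u)\<close> and one complex number. Writing that number as \<open>cnj k + g\<^sup>2/2\<close> gives
  \<open>k = 2 (\<partial>\<^sup>2u/\<partial>z\<^sup>2 - (\<partial>u/\<partial>z)\<^sup>2)\<close>, the Schwarzian derivative of the developing map of the metric. Liouville's
  equation makes the differential form \<open>w\<^sup>2/2 dz + exp (2u)/2 d(cnj z)\<close> closed; subtracting a primitive
  of it from \<open>w\<close> leaves a function with complex derivative \<open>k\<close>, so \<open>k\<close> is holomorphic
  (\<open>liouville_quadratic_differential_holomorphic\<close>). All third derivatives of \<open>u\<close> therefore exist and are
  controlled by \<open>u\<close>, \<open>g\<close>, \<open>k\<close> and \<open>k'\<close>.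

  Bounds on \<open>u\<close> give bounds on \<open>g\<close>, and these give bounds on \<open>k\<close>, by two applications of Bernstein's
  method: the maximum principle for \<open>\<eta>\<^sup>2Q + W\<close>, where \<open>Q\<close> is \<open>\<bar>g\<bar>\<^sup>2\<close> or \<open>\<bar>k\<bar>\<^sup>2\<close>, \<open>\<eta>\<close> vanishes on the boundary
  of a disc and \<open>\<Delta>W\<close> absorbs the error terms (\<open>bernstein_estimate\<close>). Cauchy's inequality then bounds
  \<open>k'\<close>. Hence the gradients and the Hessians of the \<open>u\<^sub>j\<close> are locally Lipschitz with constants independent
  of \<open>j\<close>. Under such a uniform Lipschitz bound, pointwise convergence of functions forces pointwise
  convergence of their derivatives to the derivative of the limit (\<open>has_derivative_pointwise_limit\<close>);
  applied to the \<open>u\<^sub>j\<close> and then to their gradients, this shows that the limit is \<open>C\<^sup>2\<close> and solves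
  Liouville's equation, without passing to subsequences.
\<close>

section \<open>Gradients and Hessians\<close>

text \<open>The gradient is a vector field and the Hessian is its derivative, a field of linear maps. Working with
total derivatives makes the usual rules of calculus available; the translation to iterated partial
derivatives is made only at the two ends of the argument.\<close>
definition has_hessian_on ::
    "('a::euclidean_space \<Rightarrow> real) \<Rightarrow> ('a \<Rightarrow> 'a) \<Rightarrow> ('a \<Rightarrow> 'a \<Rightarrow> 'a) \<Rightarrow> 'a set \<Rightarrow> bool" where
  "has_hessian_on f g H S \<longleftrightarrow>
     (\<forall>z\<in>S. GDERIV f z :> g z \<and> (g has_derivative H z) (at z))"

definition trace_of :: "('a::euclidean_space \<Rightarrow> 'a) \<Rightarrow> real" where
  "trace_of D = (\<Sum>b\<in>Basis. D b \<bullet> b)"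

definition has_laplacian_on ::
    "('a::euclidean_space \<Rightarrow> real) \<Rightarrow> ('a \<Rightarrow> 'a) \<Rightarrow> ('a \<Rightarrow> real) \<Rightarrow> 'a set \<Rightarrow> bool" where
  "has_laplacian_on f g L S \<longleftrightarrow> (\<exists>H. has_hessian_on f g H S \<and> (\<forall>z\<in>S. trace_of (H z) = L z))"

lemma GDERIV_line:
  assumes "GDERIV f (z + t *\<^sub>R v) :> D"
  shows "((\<lambda>s. f (z + s *\<^sub>R v)) has_real_derivative D \<bullet> v) (at t)"
proof -
  have "((\<lambda>s. z + s *\<^sub>R v) has_derivative (\<lambda>s. s *\<^sub>R v)) (at t)"
    by (auto intro!: derivative_eq_intros)
  from has_derivative_compose[OF this assms[unfolded gderiv_def]]
  show ?thesis
    by (simp add: has_field_derivative_def inner_commute mult_commute_abs)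
qed

section \<open>Symmetry of the Hessian and existence of potentials\<close>

text \<open>The mixed second difference of \<open>f\<close> over the parallelogram spanned by \<open>hv\<close> and \<open>hw\<close>, divided by \<open>h\<^sup>2\<close>, tends
to \<open>D w \<bullet> v\<close>: apply the mean value theorem along \<open>v\<close> to the difference of \<open>f\<close> on two parallel sides, and then
expand the gradient to first order at \<open>z\<close>.\<close>
lemma hessian_symmetric_aux:
  fixes f :: "'a::real_inner \<Rightarrow> real"
  assumes S: "open S" "z \<in> S" and f: "\<And>x. x \<in> S \<Longrightarrow> GDERIV f x :> g x"
    and g: "(g has_derivative D) (at z)" and e: "e > 0"
  obtains d where "d > 0"
    "\<And>h. 0 < h \<Longrightarrow> h < d \<Longrightarrow>
       \<bar>f (z + h *\<^sub>R v + h *\<^sub>R w) - f (z + h *\<^sub>R v) - f (z + h *\<^sub>R w) + f z - h\<^sup>2 * (D w \<bullet> v)\<bar> \<le> e * h\<^sup>2"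
proof -
  interpret D: bounded_linear D using g by (rule has_derivative_bounded_linear)
  \<comment> \<open>The first-order errors of \<open>g\<close> at two points of the parallelogram, paired with \<open>v\<close>, add up to at most \<open>e' h (N - 1)\<close>.\<close>
  define N where "N = 2 * (norm v + norm w) * norm v + 1"
  have N: "N > 0" by (auto simp: N_def intro!: add_nonneg_pos)
  define e' where "e' = e / N"
  have e': "e' > 0" using e N by (simp add: e'_def)
  obtain d1 where d1: "d1 > 0"
    "\<And>y. norm (y - z) < d1 \<Longrightarrow> norm (g y - g z - D (y - z)) \<le> e' * norm (y - z)"
    using g e' unfolding has_derivative_at_alt by blast
  obtain d2 where d2: "d2 > 0" "ball z d2 \<subseteq> S" using S openE by blast
  define c where "c = norm v + norm w + 1"
  have c: "c > 0" by (auto simp: c_def intro!: add_nonneg_pos)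
  define d where "d = min d1 d2 / c"
  have "d > 0" using d1 d2 c by (simp add: d_def)
  moreover have "\<bar>f (z + h *\<^sub>R v + h *\<^sub>R w) - f (z + h *\<^sub>R v) - f (z + h *\<^sub>R w) + f z - h\<^sup>2 * (D w \<bullet> v)\<bar> \<le> e * h\<^sup>2"
    if h: "0 < h" "h < d" for h
  proof -
    have hc: "h * c < d1" "h * c < d2" using h c unfolding d_def by (auto simp: pos_less_divide_eq)
    have small: "norm (s *\<^sub>R v + t *\<^sub>R w) \<le> h * (norm v + norm w)"
      if "0 \<le> s" "s \<le> h" "0 \<le> t" "t \<le> h" for s t
    proof -
      have "norm (s *\<^sub>R v + t *\<^sub>R w) \<le> s * norm v + t * norm w"
        using that by (metis abs_of_nonneg norm_scaleR norm_triangle_ineq)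
      also have "\<dots> \<le> h * norm v + h * norm w"
        using that by (intro add_mono mult_right_mono) auto
      finally show ?thesis by (simp add: algebra_simps)
    qed
    have less: "h * (norm v + norm w) < h * c" using h by (simp add: c_def)
    have inS: "z + s *\<^sub>R v + t *\<^sub>R w \<in> S" if "0 \<le> s" "s \<le> h" "0 \<le> t" "t \<le> h" for s t
    proof -
      have "norm (s *\<^sub>R v + t *\<^sub>R w) < d2" using small[OF that] less hc by linarith
      moreover have "dist z (z + s *\<^sub>R v + t *\<^sub>R w) = norm (s *\<^sub>R v + t *\<^sub>R w)"
        by (metis add.assoc add_diff_cancel_left' dist_commute dist_norm)
      ultimately show ?thesis using d2(2) by (auto simp: subset_iff mem_ball)
    qed
    define \<phi> where "\<phi> s = f ((z + h *\<^sub>R w) + s *\<^sub>R v) - f (z + s *\<^sub>R v)" for s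
    have der: "DERIV \<phi> s :> (g (z + h *\<^sub>R w + s *\<^sub>R v) - g (z + s *\<^sub>R v)) \<bullet> v" if "0 \<le> s" "s \<le> h" for s
      unfolding \<phi>_def inner_diff_left
      using inS[OF that, of h] inS[OF that, of 0] h
      by (intro DERIV_diff GDERIV_line f) (auto simp: add_ac)
    obtain \<xi> where \<xi>: "0 < \<xi>" "\<xi> < h"
      "\<phi> h - \<phi> 0 = h * ((g (z + h *\<^sub>R w + \<xi> *\<^sub>R v) - g (z + \<xi> *\<^sub>R v)) \<bullet> v)"
      using MVT2[OF h(1), of \<phi> "\<lambda>s. (g (z + h *\<^sub>R w + s *\<^sub>R v) - g (z + s *\<^sub>R v)) \<bullet> v"] der by auto
    define y1 where "y1 = z + h *\<^sub>R w + \<xi> *\<^sub>R v"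
    define y2 where "y2 = z + \<xi> *\<^sub>R v"
    have n1: "norm (y1 - z) \<le> h * (norm v + norm w)"
      using small[of \<xi> h] \<xi> h by (simp add: y1_def add_ac)
    have n2: "norm (y2 - z) \<le> h * (norm v + norm w)"
      using small[of \<xi> 0] \<xi> h by (simp add: y2_def)
    have b1: "norm (g y1 - g z - D (y1 - z)) \<le> e' * (h * (norm v + norm w))"
      using d1(2)[of y1] n1 less hc e' by (meson le_less_trans less_trans mult_left_mono order_trans less_imp_le)
    have b2: "norm (g y2 - g z - D (y2 - z)) \<le> e' * (h * (norm v + norm w))"
      using d1(2)[of y2] n2 less hc e' by (meson le_less_trans less_trans mult_left_mono order_trans less_imp_le)
    have "y1 - z = (y2 - z) + h *\<^sub>R w" by (simp add: y1_def y2_def)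
    then have "D (y1 - z) = D (y2 - z) + h *\<^sub>R D w" by (simp only: D.add D.scaleR)
    then have eq: "g y1 - g y2 - h *\<^sub>R D w = (g y1 - g z - D (y1 - z)) - (g y2 - g z - D (y2 - z))"
      by (simp add: algebra_simps)
    have "norm (g y1 - g y2 - h *\<^sub>R D w) \<le> 2 * (e' * (h * (norm v + norm w)))"
      unfolding eq using b1 b2 norm_triangle_ineq4 by (smt (verit))
    then have "\<bar>(g y1 - g y2 - h *\<^sub>R D w) \<bullet> v\<bar> \<le> 2 * (e' * (h * (norm v + norm w))) * norm v"
      by (meson Cauchy_Schwarz_ineq2 mult_right_mono norm_ge_zero order_trans)
    also have "\<dots> = e' * h * (N - 1)" by (simp add: N_def algebra_simps)
    also have "\<dots> \<le> e' * h * N" using e' h by (intro mult_left_mono) auto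
    also have "\<dots> = e * h" using N by (simp add: e'_def)
    finally have *: "\<bar>(g y1 - g y2 - h *\<^sub>R D w) \<bullet> v\<bar> \<le> e * h" .
    have "f (z + h *\<^sub>R v + h *\<^sub>R w) - f (z + h *\<^sub>R v) - f (z + h *\<^sub>R w) + f z = \<phi> h - \<phi> 0"
      by (simp add: \<phi>_def add_ac)
    then have "f (z + h *\<^sub>R v + h *\<^sub>R w) - f (z + h *\<^sub>R v) - f (z + h *\<^sub>R w) + f z - h\<^sup>2 * (D w \<bullet> v)
      = h * ((g y1 - g y2 - h *\<^sub>R D w) \<bullet> v)"
      using \<xi>(3) by (simp add: y1_def y2_def inner_diff_left power2_eq_square algebra_simps)
    then show ?thesis using * h
      by (simp add: abs_mult power2_eq_square mult.assoc)
  qed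
  ultimately show ?thesis using that by blast
qed

text \<open>The second difference in the previous lemma is symmetric in \<open>v\<close> and \<open>w\<close>, so its limit is too.\<close>
lemma hessian_symmetric:
  fixes f :: "'a::real_inner \<Rightarrow> real"
  assumes S: "open S" "z \<in> S" and f: "\<And>x. x \<in> S \<Longrightarrow> GDERIV f x :> g x"
    and g: "(g has_derivative D) (at z)"
  shows "D v \<bullet> w = D w \<bullet> v"
proof -
  have "\<bar>D v \<bullet> w - D w \<bullet> v\<bar> \<le> 0 + e" if e: "e > 0" for e
  proof -
    obtain d1 where d1: "d1 > 0" "\<And>h. 0 < h \<Longrightarrow> h < d1 \<Longrightarrow>
       \<bar>f (z + h *\<^sub>R v + h *\<^sub>R w) - f (z + h *\<^sub>R v) - f (z + h *\<^sub>R w) + f z - h\<^sup>2 * (D w \<bullet> v)\<bar> \<le> e/2 * h\<^sup>2"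
      using hessian_symmetric_aux[OF S f g, of "e/2" v w] e by auto
    obtain d2 where d2: "d2 > 0" "\<And>h. 0 < h \<Longrightarrow> h < d2 \<Longrightarrow>
       \<bar>f (z + h *\<^sub>R w + h *\<^sub>R v) - f (z + h *\<^sub>R w) - f (z + h *\<^sub>R v) + f z - h\<^sup>2 * (D v \<bullet> w)\<bar> \<le> e/2 * h\<^sup>2"
      using hessian_symmetric_aux[OF S f g, of "e/2" w v] e by auto
    define h where "h = min d1 d2 / 2"
    have h: "0 < h" "h < d1" "h < d2" using d1 d2 by (auto simp: h_def min_def)
    have "\<bar>h\<^sup>2 * (D v \<bullet> w) - h\<^sup>2 * (D w \<bullet> v)\<bar> \<le> e * h\<^sup>2"
      using d1(2)[OF h(1,2)] d2(2)[OF h(1,3), unfolded add.assoc add.commute[of "h *\<^sub>R w" "h *\<^sub>R v"]]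
      unfolding add.assoc by linarith
    then have "h\<^sup>2 * \<bar>D v \<bullet> w - D w \<bullet> v\<bar> \<le> h\<^sup>2 * e"
      by (simp add: abs_mult flip: right_diff_distrib) (simp add: mult.commute)
    then show ?thesis using h by simp
  qed
  then have "\<bar>D v \<bullet> w - D w \<bullet> v\<bar> \<le> 0" by (rule field_le_epsilon)
  then show ?thesis by simp
qed

text \<open>The Poincare lemma, converse to \<open>hessian_symmetric\<close>. The potential is the line integral of \<open>X\<close> along the
segment from \<open>a\<close> to \<open>x\<close>. Differentiating under the integral sign and using symmetry, the integrand of the
gradient becomes the \<open>t\<close>-derivative of \<open>t X(a + t(x - a))\<close>.\<close>
lemma symmetric_field_has_potential:
  fixes X :: "'a::euclidean_space \<Rightarrow> 'a"
  assumes U: "convex U" "open U" "a \<in> U"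
    and X: "\<And>x. x \<in> U \<Longrightarrow> (X has_derivative X' x) (at x)"
    and sym: "\<And>x v w. x \<in> U \<Longrightarrow> X' x v \<bullet> w = X' x w \<bullet> v"
    and cont: "continuous_on (U \<times> UNIV) (\<lambda>(x, v). X' x v)"
  obtains F where "\<And>x. x \<in> U \<Longrightarrow> GDERIV F x :> X x"
proof
  define \<gamma> where "\<gamma> x t = a + t *\<^sub>R (x - a)" for x and t :: real
  have \<gamma>U: "\<gamma> x t \<in> U" if "x \<in> U" "t \<in> cbox 0 1" for x t
  proof -
    have "\<gamma> x t = (1 - t) *\<^sub>R a + t *\<^sub>R x" by (simp add: \<gamma>_def algebra_simps)
    then show ?thesis using convexD_alt[OF U(1,3) that(1), of t] that(2) by simp
  qed
  define G where "G x t = X (\<gamma> x t) + t *\<^sub>R X' (\<gamma> x t) (x - a)" for x t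
  define F where "F x = integral (cbox 0 1) (\<lambda>t. X (\<gamma> x t) \<bullet> (x - a))" for x
  have contX: "continuous_on U X"
    using X has_derivative_continuous continuous_at_imp_continuous_on by blast
  have cont\<gamma>: "continuous_on A (\<lambda>p. \<gamma> (u p) (v p))" if "continuous_on A u" "continuous_on A v"
    for u v and A :: "'c::topological_space set"
    unfolding \<gamma>_def using that by (intro continuous_intros)
  have contG: "continuous_on (U \<times> cbox 0 1) (\<lambda>(x, t). G x t)"
    unfolding G_def case_prod_unfold
    by (intro continuous_intros continuous_on_compose2[OF contX] cont\<gamma>
        continuous_on_compose2[OF cont, of _ "\<lambda>p. (\<gamma> (fst p) (snd p), fst p - a)", simplified case_prod_conv])
      (auto intro!: \<gamma>U)
  fix x assume x: "x \<in> U"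
  have lin: "bounded_linear (X' y)" if "y \<in> U" for y using X[OF that] by (rule has_derivative_bounded_linear)
  have "(F has_derivative integral (cbox 0 1) (\<lambda>t. blinfun_inner_left (G x t))) (at x within U)"
    unfolding F_def
  proof (rule leibniz_rule[where U=U])
    fix y t assume y: "y \<in> U" and t: "t \<in> cbox (0::real) 1"
    have "((\<lambda>y. X (\<gamma> y t)) has_derivative (\<lambda>h. X' (\<gamma> y t) (t *\<^sub>R h))) (at y within U)"
      by (rule has_derivative_compose[of "\<lambda>y. \<gamma> y t" _ _ _ X])
        (auto simp: \<gamma>_def intro!: derivative_eq_intros X[OF \<gamma>U[OF y t, unfolded \<gamma>_def]])
    then have "((\<lambda>y. X (\<gamma> y t) \<bullet> (y - a)) has_derivative
       (\<lambda>h. X (\<gamma> y t) \<bullet> h + X' (\<gamma> y t) (t *\<^sub>R h) \<bullet> (y - a))) (at y within U)"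
      by (auto intro!: derivative_eq_intros)
    moreover have "X (\<gamma> y t) \<bullet> h + X' (\<gamma> y t) (t *\<^sub>R h) \<bullet> (y - a) = h \<bullet> G y t" for h
      using sym[OF \<gamma>U[OF y t], of h "y - a"] bounded_linear.linear[OF lin[OF \<gamma>U[OF y t]]]
      by (simp add: G_def inner_add_right inner_commute linear_cmul)
    ultimately show "((\<lambda>y. X (\<gamma> y t) \<bullet> (y - a)) has_derivative blinfun_apply (blinfun_inner_left (G y t))) (at y within U)"
      by (simp add: blinfun_inner_left.rep_eq)
  next
    fix y assume "y \<in> U"
    then show "(\<lambda>t. X (\<gamma> y t) \<bullet> (y - a)) integrable_on cbox 0 1"
      by (intro integrable_continuous continuous_intros continuous_on_compose2[OF contX] cont\<gamma>) (auto intro: \<gamma>U)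
  next
    show "continuous_on (U \<times> cbox 0 1) (\<lambda>(x, t). blinfun_inner_left (G x t))"
      using contG unfolding case_prod_unfold by (intro continuous_intros) auto
  qed (use x U in auto)
  moreover have "integral (cbox 0 1) (\<lambda>t. blinfun_inner_left (G x t)) = blinfun_inner_left (X x)"
  proof -
    have "(G x has_integral (1 *\<^sub>R X (\<gamma> x 1) - 0 *\<^sub>R X (\<gamma> x 0))) {0..1}"
    proof (rule fundamental_theorem_of_calculus)
      fix t :: real assume t: "t \<in> {0..1}"
      then have t': "\<gamma> x t \<in> U" using \<gamma>U x by auto
      have "((\<lambda>t. X (\<gamma> x t)) has_derivative (\<lambda>s. X' (\<gamma> x t) (s *\<^sub>R (x - a)))) (at t within {0..1})"
        by (rule has_derivative_compose[of "\<lambda>t. \<gamma> x t" _ _ _ X])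
          (auto simp: \<gamma>_def intro!: derivative_eq_intros X[OF t'[unfolded \<gamma>_def]])
      then have "((\<lambda>t. X (\<gamma> x t)) has_vector_derivative X' (\<gamma> x t) (x - a)) (at t within {0..1})"
        using bounded_linear.linear[OF lin[OF t']] by (simp add: has_vector_derivative_def linear_cmul)
      then have "((\<lambda>t. t *\<^sub>R X (\<gamma> x t)) has_vector_derivative t *\<^sub>R X' (\<gamma> x t) (x - a) + 1 *\<^sub>R X (\<gamma> x t)) (at t within {0..1})"
        by (intro has_vector_derivative_scaleR DERIV_ident)
      then show "((\<lambda>t. t *\<^sub>R X (\<gamma> x t)) has_vector_derivative G x t) (at t within {0..1})"
        by (simp add: G_def add.commute)
    qed auto
    then have "(G x has_integral X x) (cbox 0 1)" by (simp add: \<gamma>_def)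
    from has_integral_linear[OF this bounded_linear_blinfun_inner_left]
    show ?thesis by (simp add: o_def integral_unique)
  qed
  ultimately have "(F has_derivative blinfun_inner_left (X x)) (at x within U)" by metis
  then show "GDERIV F x :> X x"
    unfolding gderiv_def at_within_open[OF x U(2)] blinfun_inner_left.rep_eq .
qed

section \<open>Calculus with Laplacians\<close>

lemma trace_of_add: "trace_of (\<lambda>h. D h + D' h) = trace_of D + trace_of D'"
  by (simp add: trace_of_def inner_add_left sum.distrib)

lemma trace_of_scaleR: "trace_of (\<lambda>h. c *\<^sub>R D h) = c * trace_of D"
  by (simp add: trace_of_def sum_distrib_left)

lemma trace_of_rank_one: "trace_of (\<lambda>h. (h \<bullet> v) *\<^sub>R w) = v \<bullet> w"
  by (simp add: trace_of_def euclidean_inner[of v w] inner_commute)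

lemma trace_of_id: "trace_of (\<lambda>h::'a::euclidean_space. h) = DIM('a)"
  by (simp add: trace_of_def inner_same_Basis)

lemma has_laplacian_onI:
  assumes "\<And>z. z \<in> S \<Longrightarrow> GDERIV f z :> g z" "\<And>z. z \<in> S \<Longrightarrow> (g has_derivative H z) (at z)"
    "\<And>z. z \<in> S \<Longrightarrow> trace_of (H z) = L z"
  shows "has_laplacian_on f g L S"
  using assms unfolding has_laplacian_on_def has_hessian_on_def by blast

lemma has_laplacian_on_subset: "has_laplacian_on f g L S \<Longrightarrow> T \<subseteq> S \<Longrightarrow> has_laplacian_on f g L T"
  unfolding has_laplacian_on_def has_hessian_on_def by blast

lemma has_laplacian_on_cong:
  assumes "has_laplacian_on f g L S" "\<And>z. f z = f' z" "\<And>z. g z = g' z" "\<And>z. z \<in> S \<Longrightarrow> L z = L' z"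
  shows "has_laplacian_on f' g' L' S"
proof -
  have "f' = f" "g' = g" using assms by auto
  then show ?thesis using assms unfolding has_laplacian_on_def by auto
qed

lemma has_laplacian_on_const: "has_laplacian_on (\<lambda>_. c) (\<lambda>_. 0) (\<lambda>_. 0) S"
  by (rule has_laplacian_onI[where H = "\<lambda>_ _. 0"]) (auto simp: GDERIV_const trace_of_def)

lemma has_laplacian_on_add:
  assumes "has_laplacian_on f g L S" "has_laplacian_on f' g' L' S"
  shows "has_laplacian_on (\<lambda>z. f z + f' z) (\<lambda>z. g z + g' z) (\<lambda>z. L z + L' z) S"
proof -
  obtain H H' where "has_hessian_on f g H S" "\<forall>z\<in>S. trace_of (H z) = L z"
    "has_hessian_on f' g' H' S" "\<forall>z\<in>S. trace_of (H' z) = L' z"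
    using assms unfolding has_laplacian_on_def by blast
  then show ?thesis unfolding has_hessian_on_def
    by (intro has_laplacian_onI[where H = "\<lambda>z h. H z h + H' z h"])
      (auto simp: trace_of_add intro!: GDERIV_add derivative_intros)
qed

lemma has_laplacian_on_mult:
  assumes "has_laplacian_on f g L S" "has_laplacian_on f' g' L' S"
  shows "has_laplacian_on (\<lambda>z. f z * f' z) (\<lambda>z. f z *\<^sub>R g' z + f' z *\<^sub>R g z)
           (\<lambda>z. f z * L' z + f' z * L z + 2 * (g z \<bullet> g' z)) S"
proof -
  obtain H H' where H: "has_hessian_on f g H S" "\<forall>z\<in>S. trace_of (H z) = L z"
    "has_hessian_on f' g' H' S" "\<forall>z\<in>S. trace_of (H' z) = L' z"
    using assms unfolding has_laplacian_on_def by blast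
  define K where "K z h = (f z *\<^sub>R H' z h + (h \<bullet> g z) *\<^sub>R g' z) + (f' z *\<^sub>R H z h + (h \<bullet> g' z) *\<^sub>R g z)" for z h
  show ?thesis
  proof (rule has_laplacian_onI[where H = K])
    fix z assume z: "z \<in> S"
    show "GDERIV (\<lambda>z. f z * f' z) z :> f z *\<^sub>R g' z + f' z *\<^sub>R g z"
      using H z unfolding has_hessian_on_def by (intro GDERIV_mult) auto
    have "(f has_derivative (\<lambda>h. h \<bullet> g z)) (at z)" "(f' has_derivative (\<lambda>h. h \<bullet> g' z)) (at z)"
      "(g has_derivative H z) (at z)" "(g' has_derivative H' z) (at z)"
      using H z unfolding has_hessian_on_def gderiv_def by auto
    then show "((\<lambda>z. f z *\<^sub>R g' z + f' z *\<^sub>R g z) has_derivative K z) (at z)"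
      unfolding K_def by (intro derivative_intros)
    show "trace_of (K z) = f z * L' z + f' z * L z + 2 * (g z \<bullet> g' z)"
      unfolding K_def using H z by (simp add: trace_of_add trace_of_scaleR trace_of_rank_one inner_commute)
  qed
qed

lemma has_laplacian_on_cmult:
  assumes "has_laplacian_on f g L S"
  shows "has_laplacian_on (\<lambda>z. c * f z) (\<lambda>z. c *\<^sub>R g z) (\<lambda>z. c * L z) S"
  using has_laplacian_on_mult[OF has_laplacian_on_const[of c] assms] by simp

lemma has_hessian_on_continuous:
  assumes "has_hessian_on f g H S"
  shows "continuous_on S f" "continuous_on S g"
  using assms unfolding has_hessian_on_def gderiv_def
  by (meson continuous_at_imp_continuous_on has_derivative_continuous)+

lemma has_hessian_on_compose:
  assumes "has_hessian_on f g H S"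
    "\<And>z. z \<in> S \<Longrightarrow> DERIV \<phi> (f z) :> \<phi>' (f z)" "\<And>z. z \<in> S \<Longrightarrow> DERIV \<phi>' (f z) :> \<phi>'' (f z)"
  shows "has_hessian_on (\<lambda>z. \<phi> (f z)) (\<lambda>z. \<phi>' (f z) *\<^sub>R g z)
     (\<lambda>z h. \<phi>' (f z) *\<^sub>R H z h + \<phi>'' (f z) *\<^sub>R ((h \<bullet> g z) *\<^sub>R g z)) S"
  unfolding has_hessian_on_def
proof (intro ballI conjI)
  fix z assume z: "z \<in> S"
  show "GDERIV (\<lambda>z. \<phi> (f z)) z :> \<phi>' (f z) *\<^sub>R g z"
    using assms z unfolding has_hessian_on_def by (intro GDERIV_DERIV_compose) auto
  have "GDERIV (\<lambda>z. \<phi>' (f z)) z :> \<phi>'' (f z) *\<^sub>R g z"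
    using assms z unfolding has_hessian_on_def by (intro GDERIV_DERIV_compose[of f z "g z" \<phi>' "\<phi>'' (f z)"]) auto
  moreover have "(g has_derivative H z) (at z)" using assms z unfolding has_hessian_on_def by auto
  ultimately show "((\<lambda>z. \<phi>' (f z) *\<^sub>R g z) has_derivative
      (\<lambda>h. \<phi>' (f z) *\<^sub>R H z h + \<phi>'' (f z) *\<^sub>R ((h \<bullet> g z) *\<^sub>R g z))) (at z)"
    unfolding gderiv_def by (auto intro!: derivative_eq_intros simp: algebra_simps)
qed

lemma has_laplacian_on_compose:
  assumes "has_laplacian_on f g L S"
    "\<And>z. z \<in> S \<Longrightarrow> DERIV \<phi> (f z) :> \<phi>' (f z)" "\<And>z. z \<in> S \<Longrightarrow> DERIV \<phi>' (f z) :> \<phi>'' (f z)"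
  shows "has_laplacian_on (\<lambda>z. \<phi> (f z)) (\<lambda>z. \<phi>' (f z) *\<^sub>R g z)
     (\<lambda>z. \<phi>' (f z) * L z + \<phi>'' (f z) * (norm (g z))\<^sup>2) S"
proof -
  obtain H where H: "has_hessian_on f g H S" "\<forall>z\<in>S. trace_of (H z) = L z"
    using assms unfolding has_laplacian_on_def by blast
  show ?thesis
    unfolding has_laplacian_on_def
    using has_hessian_on_compose[OF H(1), of \<phi> \<phi>' \<phi>''] assms(2,3) H(2)
    by (intro exI conjI, blast)
      (simp add: trace_of_add trace_of_scaleR[of _ "\<lambda>h. (h \<bullet> _) *\<^sub>R _"] trace_of_scaleR
        trace_of_rank_one power2_norm_eq_inner del: scaleR_scaleR)
qed

lemma has_laplacian_on_norm_sq:
  "has_laplacian_on (\<lambda>z::'a::euclidean_space. (norm (z - a))\<^sup>2) (\<lambda>z. 2 *\<^sub>R (z - a)) (\<lambda>_. 2 * real DIM('a)) S"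
proof (rule has_laplacian_onI[where H = "\<lambda>z h. 2 *\<^sub>R h"])
  fix z
  show "GDERIV (\<lambda>z. (norm (z - a))\<^sup>2) z :> 2 *\<^sub>R (z - a)"
    unfolding gderiv_def power2_norm_eq_inner
    by (auto intro!: derivative_eq_intros simp: inner_commute)
  show "((\<lambda>z. 2 *\<^sub>R (z - a)) has_derivative (\<lambda>h. 2 *\<^sub>R h)) (at z)"
    by (auto intro!: derivative_eq_intros)
  show "trace_of (\<lambda>h::'a. 2 *\<^sub>R h) = 2 * real DIM('a)"
    by (simp add: trace_of_scaleR trace_of_id)
qed

section \<open>The maximum principle and its consequences\<close>

text \<open>If some pure second derivative \<open>H z b \<bullet> b\<close> were positive, the directional derivative along \<open>b\<close>, which vanishes
at the maximum, would be positive just after it, and \<open>f\<close> would increase.\<close>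
lemma laplacian_nonpos_at_max:
  assumes L: "has_laplacian_on f g L S" and S: "open S" "z \<in> S" and max: "\<And>w. w \<in> S \<Longrightarrow> f w \<le> f z"
  shows "L z \<le> 0"
proof -
  obtain H where H: "has_hessian_on f g H S" "\<forall>z\<in>S. trace_of (H z) = L z"
    using L unfolding has_laplacian_on_def by blast
  obtain d where d: "d > 0" "ball z d \<subseteq> S" using S openE by blast
  have "H z b \<bullet> b \<le> 0" if b: "b \<in> Basis" for b
  proof (rule ccontr)
    assume neg: "\<not> H z b \<bullet> b \<le> 0"
    have inS: "z + t *\<^sub>R b \<in> S" if "\<bar>t\<bar> < d" for t
      using d that b by (auto simp: subset_iff dist_norm)
    have der: "DERIV (\<lambda>t. f (z + t *\<^sub>R b)) t :> g (z + t *\<^sub>R b) \<bullet> b" if "\<bar>t\<bar> < d" for t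
      using H(1) inS[OF that] unfolding has_hessian_on_def by (intro GDERIV_line) auto
    have "g (z + 0 *\<^sub>R b) \<bullet> b = 0"
      using der[of 0] d inS max by (intro DERIV_local_max[of "\<lambda>t. f (z + t *\<^sub>R b)" _ 0 d]) auto
    then have g0: "g z \<bullet> b = 0" by simp
    have line: "((\<lambda>t. z + t *\<^sub>R b) has_derivative (\<lambda>t. t *\<^sub>R b)) (at 0)"
      by (auto intro!: derivative_eq_intros)
    have "(g has_derivative H z) (at (z + 0 *\<^sub>R b))"
      using H(1) S unfolding has_hessian_on_def by auto
    from has_derivative_compose[OF line this]
    have "((\<lambda>t. g (z + t *\<^sub>R b) \<bullet> b) has_derivative (\<lambda>t. H z (t *\<^sub>R b) \<bullet> b)) (at 0)"
      by (auto intro!: derivative_eq_intros)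
    moreover have "linear (H z)"
      using H(1) S unfolding has_hessian_on_def by (meson has_derivative_linear)
    ultimately have "DERIV (\<lambda>t. g (z + t *\<^sub>R b) \<bullet> b) 0 :> H z b \<bullet> b"
      by (simp add: has_field_derivative_def linear_cmul mult_commute_abs)
    from DERIV_pos_inc_right[OF this] neg g0
    obtain e where e: "e > 0" "\<And>h. 0 < h \<Longrightarrow> h < e \<Longrightarrow> 0 < g (z + h *\<^sub>R b) \<bullet> b" by auto
    define h where "h = min d e / 2"
    have h: "0 < h" "h < d" "h < e" using d e by (auto simp: h_def min_def)
    obtain \<xi> where \<xi>: "0 < \<xi>" "\<xi> < h" "f (z + h *\<^sub>R b) - f (z + 0 *\<^sub>R b) = (h - 0) * (g (z + \<xi> *\<^sub>R b) \<bullet> b)"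
      using MVT2[OF h(1), of "\<lambda>t. f (z + t *\<^sub>R b)" "\<lambda>t. g (z + t *\<^sub>R b) \<bullet> b"] der h by auto
    have "0 < (h - 0) * (g (z + \<xi> *\<^sub>R b) \<bullet> b)" using e(2)[of \<xi>] \<xi> h by (intro mult_pos_pos) auto
    then show False using \<xi>(3) max[OF inS[of h]] h by simp
  qed
  then have "trace_of (H z) \<le> 0" unfolding trace_of_def by (rule sum_nonpos)
  then show ?thesis using H S by simp
qed

text \<open>Adding a small multiple of \<open>\<bar>z - a\<bar>\<^sup>2\<close> makes the Laplacian strictly positive, which excludes an interior
maximum.\<close>
lemma weak_maximum_principle:
  fixes f :: "'a::euclidean_space \<Rightarrow> real"
  assumes cont: "continuous_on (cball a r) f" and L: "has_laplacian_on f g L (ball a r)"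
    and nonneg: "\<And>z. z \<in> ball a r \<Longrightarrow> 0 \<le> L z"
    and C: "\<And>z. z \<in> sphere a r \<Longrightarrow> f z \<le> C" and z: "z \<in> cball a r"
  shows "f z \<le> C"
proof (rule field_le_epsilon)
  fix e :: real assume "e > 0"
  define e' where "e' = e / (r\<^sup>2 + 1)"
  have p: "r\<^sup>2 + 1 > 0" by (simp add: add_nonneg_pos)
  have e': "e' > 0" using \<open>e > 0\<close> p by (simp add: e'_def)
  define F where "F z = f z + e' * (norm (z - a))\<^sup>2" for z
  have F: "has_laplacian_on F (\<lambda>z. g z + e' *\<^sub>R (2 *\<^sub>R (z - a))) (\<lambda>z. L z + e' * (2 * real DIM('a))) (ball a r)"
    unfolding F_def by (intro has_laplacian_on_add has_laplacian_on_cmult has_laplacian_on_norm_sq L)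
  have contF: "continuous_on (cball a r) F" unfolding F_def by (intro continuous_intros cont)
  obtain x where x: "x \<in> cball a r" "\<And>y. y \<in> cball a r \<Longrightarrow> F y \<le> F x"
    using continuous_attains_sup[OF compact_cball _ contF] z by blast
  have "x \<notin> ball a r"
  proof
    assume b: "x \<in> ball a r"
    have "L x + e' * (2 * real DIM('a)) \<le> 0"
      using laplacian_nonpos_at_max[OF F open_ball b] x(2) by auto
    moreover have "e' * (2 * real DIM('a)) > 0" using e' by auto
    ultimately show False using nonneg[OF b] by linarith
  qed
  then have xs: "x \<in> sphere a r" using x(1) by (auto simp: dist_norm)
  have "f z \<le> F z" using e' by (simp add: F_def)
  also have "\<dots> \<le> F x" using x(2) z by blast
  also have "F x \<le> C + e' * r\<^sup>2" using C[OF xs] xs by (simp add: F_def dist_norm norm_minus_commute)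
  also have "e' * r\<^sup>2 \<le> e" using \<open>e > 0\<close> p by (simp add: e'_def field_simps)
  finally show "f z \<le> C + e" by simp
qed

lemma has_laplacian_on_defining_function:
  "has_laplacian_on (\<lambda>z::complex. r\<^sup>2 - (norm (z - a))\<^sup>2) (\<lambda>z. - 2 *\<^sub>R (z - a)) (\<lambda>_. - 4) S"
  by (rule has_laplacian_on_cong[OF has_laplacian_on_add[OF has_laplacian_on_const[of "r\<^sup>2"]
        has_laplacian_on_cmult[OF has_laplacian_on_norm_sq[of a S], of "-1"]]]) auto

text \<open>The function \<open>\<eta>\<^sup>2Q + W\<close> with \<open>\<eta> = r\<^sup>2 - \<bar>z - a\<bar>\<^sup>2\<close> is subharmonic and equals \<open>W\<close> on the boundary, while its
value at the centre is \<open>r\<^sup>4Q(a) + W(a)\<close>. In the Laplacian of \<open>\<eta>\<^sup>2Q\<close> the cross term between the gradients of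
\<open>\<eta>\<^sup>2\<close> and \<open>Q\<close> is dominated, through \<open>\<bar>\<nabla>Q\<bar>\<^sup>2 \<le> 2Q\<Delta>Q\<close>, by \<open>\<eta>\<^sup>2\<Delta>Q\<close> plus a multiple of \<open>Q\<close>, which \<open>\<Delta>W\<close> absorbs.
The inequality \<open>\<bar>\<nabla>Q\<bar>\<^sup>2 \<le> 2Q\<Delta>Q\<close> is typical of squared norms of derivatives of solutions.\<close>
lemma bernstein_estimate:
  fixes Q W :: "complex \<Rightarrow> real"
  assumes r: "r > 0"
    and Q: "has_laplacian_on Q gQ LQ (ball a r)" "continuous_on (cball a r) Q"
    and W: "has_laplacian_on W gW LW (ball a r)" "continuous_on (cball a r) W"
    and nonneg: "\<And>z. z \<in> ball a r \<Longrightarrow> 0 \<le> Q z" "\<And>z. z \<in> ball a r \<Longrightarrow> 0 \<le> LQ z"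
    and grad: "\<And>z. z \<in> ball a r \<Longrightarrow> (norm (gQ z))\<^sup>2 \<le> 2 * Q z * LQ z"
    and LW: "\<And>z. z \<in> ball a r \<Longrightarrow> 24 * r\<^sup>2 * Q z \<le> LW z"
    and M: "\<And>z. z \<in> sphere a r \<Longrightarrow> W z - W a \<le> M"
  shows "r ^ 4 * Q a \<le> M"
proof -
  define \<eta> where "\<eta> z = r\<^sup>2 - (norm (z - a))\<^sup>2" for z
  define F where "F z = (\<eta> z * \<eta> z) * Q z + W z" for z
  have h: "has_laplacian_on \<eta> (\<lambda>z. - 2 *\<^sub>R (z - a)) (\<lambda>_. - 4) (ball a r)"
    unfolding \<eta>_def by (rule has_laplacian_on_defining_function)
  note F = has_laplacian_on_add[OF has_laplacian_on_mult[OF has_laplacian_on_mult[OF h h] Q(1)] W(1), folded F_def]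
  have "F a \<le> W a + M"
  proof (rule weak_maximum_principle[OF _ F])
    show "continuous_on (cball a r) F" unfolding F_def \<eta>_def by (intro continuous_intros Q W)
    show "a \<in> cball a r" using r by simp
    show "F z \<le> W a + M" if "z \<in> sphere a r" for z
      using M[OF that] that by (simp add: F_def \<eta>_def dist_norm norm_minus_commute)
  next
    fix z assume z: "z \<in> ball a r"
    define s where "s = (norm (z - a))\<^sup>2"
    define d where "d = (- 2 *\<^sub>R (z - a)) \<bullet> gQ z"
    have s: "0 \<le> s" "s < r\<^sup>2" using z by (auto simp: s_def dist_norm norm_minus_commute power_strict_mono)
    have \<eta>: "\<eta> z = r\<^sup>2 - s" by (simp add: \<eta>_def s_def)
    have "d\<^sup>2 \<le> (norm (- 2 *\<^sub>R (z - a)))\<^sup>2 * (norm (gQ z))\<^sup>2"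
      unfolding d_def by (metis Cauchy_Schwarz_ineq power2_norm_eq_inner)
    also have "\<dots> = 4 * s * (norm (gQ z))\<^sup>2" by (simp add: s_def power_mult_distrib)
    also have "\<dots> \<le> 4 * s * (2 * Q z * LQ z)" using grad[OF z] s by (intro mult_left_mono) auto
    finally have d2: "d\<^sup>2 \<le> 8 * s * Q z * LQ z" by (simp add: algebra_simps)
    \<comment> \<open>The arithmetic-geometric mean inequality for the two terms that control the cross term.\<close>
    have "(4 * \<eta> z * d)\<^sup>2 \<le> (16 * (\<eta> z)\<^sup>2) * (8 * s * Q z * LQ z)"
      unfolding power_mult_distrib using d2 by (intro mult_mono) auto
    also have "\<dots> = 4 * ((\<eta> z)\<^sup>2 * LQ z) * (32 * s * Q z)" by (simp add: algebra_simps)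
    also have "\<dots> \<le> ((\<eta> z)\<^sup>2 * LQ z + 32 * s * Q z)\<^sup>2"
      using zero_le_power2[of "(\<eta> z)\<^sup>2 * LQ z - 32 * s * Q z"]
      by (simp add: power2_eq_square algebra_simps)
    finally have sq: "(4 * \<eta> z * d)\<^sup>2 \<le> ((\<eta> z)\<^sup>2 * LQ z + 32 * s * Q z)\<^sup>2" .
    have "0 \<le> (\<eta> z)\<^sup>2 * LQ z + 32 * s * Q z" using nonneg[OF z] s by simp
    from sq this have "\<bar>4 * \<eta> z * d\<bar> \<le> (\<eta> z)\<^sup>2 * LQ z + 32 * s * Q z"
      by (rule power2_le_iff_abs_le[THEN iffD1, rotated])
    then have "0 \<le> (\<eta> z)\<^sup>2 * LQ z + 32 * s * Q z + 4 * \<eta> z * d" by linarith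
    moreover have "24 * r\<^sup>2 * Q z = 24 * s * Q z + 24 * \<eta> z * Q z" by (simp add: \<eta> algebra_simps)
    moreover have "0 \<le> \<eta> z * Q z" using \<eta> s nonneg[OF z] by simp
    ultimately have main: "0 \<le> (\<eta> z)\<^sup>2 * LQ z + (8 * s - 8 * \<eta> z) * Q z + 4 * \<eta> z * d + LW z"
      using LW[OF z] by (simp add: algebra_simps)
    define v where "v = - 2 *\<^sub>R (z - a)"
    have vv: "v \<bullet> v = 4 * s" by (simp add: v_def s_def power2_norm_eq_inner)
    have vd: "v \<bullet> gQ z = d" by (simp add: v_def d_def)
    have "\<eta> z * \<eta> z * LQ z + Q z * (\<eta> z * - 4 + \<eta> z * - 4 + 2 * (v \<bullet> v)) +
        2 * ((\<eta> z *\<^sub>R v + \<eta> z *\<^sub>R v) \<bullet> gQ z) + LW z =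
        (\<eta> z)\<^sup>2 * LQ z + (8 * s - 8 * \<eta> z) * Q z + 4 * \<eta> z * d + LW z"
      unfolding inner_add_left inner_scaleR_left vv vd by algebra
    with main show "0 \<le> \<eta> z * \<eta> z * LQ z + Q z * (\<eta> z * - 4 + \<eta> z * - 4 + 2 * (- 2 *\<^sub>R (z - a) \<bullet> - 2 *\<^sub>R (z - a))) +
        2 * ((\<eta> z *\<^sub>R - 2 *\<^sub>R (z - a) + \<eta> z *\<^sub>R - 2 *\<^sub>R (z - a)) \<bullet> gQ z) + LW z"
      unfolding v_def by linarith
  qed
  then show ?thesis by (simp add: F_def \<eta>_def power2_eq_square power4_eq_xxxx mult.assoc)
qed

text \<open>Compare with the hyperbolic metric \<open>2r / (r\<^sup>2 - \<bar>z - a\<bar>\<^sup>2)\<close>. The quotient of the two densities is, up to the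
factor \<open>2r\<close>, the function \<open>\<eta> exp u\<close>; it vanishes on the boundary, so it has an interior maximum. There the
Laplacian of its logarithm is nonpositive, which says \<open>exp (2u) \<le> 4r\<^sup>2/\<eta>\<^sup>2\<close>, so the maximum is at most \<open>2r\<close>.\<close>
lemma ahlfors_upper_bound:
  fixes u :: "complex \<Rightarrow> real"
  assumes u: "has_laplacian_on u g (\<lambda>z. exp (2 * u z)) S" and r: "r > 0" "cball a r \<subseteq> S"
  shows "u a \<le> ln (2 / r)"
proof -
  define \<eta> where "\<eta> z = r\<^sup>2 - (norm (z - a))\<^sup>2" for z
  have "continuous_on S u"
    using u unfolding has_laplacian_on_def has_hessian_on_def gderiv_def
    by (meson continuous_at_imp_continuous_on has_derivative_continuous)
  then have "continuous_on (cball a r) (\<lambda>z. \<eta> z * exp (u z))"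
    unfolding \<eta>_def using r by (intro continuous_intros) (auto intro: continuous_on_subset)
  then obtain x where x: "x \<in> cball a r" "\<And>y. y \<in> cball a r \<Longrightarrow> \<eta> y * exp (u y) \<le> \<eta> x * exp (u x)"
    using continuous_attains_sup[of "cball a r" "\<lambda>z. \<eta> z * exp (u z)"] r by auto
  have pos: "\<eta> z > 0" if "z \<in> ball a r" for z
    using that by (simp add: \<eta>_def dist_norm norm_minus_commute power_strict_mono)
  have "\<eta> a * exp (u a) > 0" using pos[of a] r by simp
  then have "\<eta> x > 0" using x(2)[of a] r by (smt (verit) centre_in_cball exp_gt_zero zero_less_mult_iff)
  then have xb: "x \<in> ball a r" using x(1) r
    by (auto simp: \<eta>_def dist_norm norm_minus_commute intro: power_less_imp_less_base)
  have sub: "ball a r \<subseteq> S" using r by auto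
  have h: "has_laplacian_on \<eta> (\<lambda>z. - 2 *\<^sub>R (z - a)) (\<lambda>_. - 4) (ball a r)"
    unfolding \<eta>_def by (rule has_laplacian_on_defining_function)
  have "has_laplacian_on (\<lambda>z. ln (\<eta> z)) (\<lambda>z. inverse (\<eta> z) *\<^sub>R (- 2 *\<^sub>R (z - a)))
     (\<lambda>z. inverse (\<eta> z) * - 4 + - (inverse (\<eta> z))\<^sup>2 * (norm (- 2 *\<^sub>R (z - a)))\<^sup>2) (ball a r)"
  proof (rule has_laplacian_on_compose[OF h, where \<phi>' = inverse and \<phi>'' = "\<lambda>t. - (inverse t)\<^sup>2"])
    fix z assume "z \<in> ball a r"
    then have "\<eta> z > 0" by (rule pos)
    then show "DERIV ln (\<eta> z) :> inverse (\<eta> z)" "DERIV inverse (\<eta> z) :> - (inverse (\<eta> z))\<^sup>2"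
      using DERIV_ln[of "\<eta> z"] DERIV_inverse[of "\<eta> z" UNIV] by (auto simp: numeral_2_eq_2)
  qed
  note sum = has_laplacian_on_add[OF this has_laplacian_on_subset[OF u sub]]
  have "inverse (\<eta> x) * - 4 + - (inverse (\<eta> x))\<^sup>2 * (norm (- 2 *\<^sub>R (x - a)))\<^sup>2 + exp (2 * u x) \<le> 0"
  proof (rule laplacian_nonpos_at_max[OF sum open_ball xb])
    fix y assume y: "y \<in> ball a r"
    have "ln (\<eta> y * exp (u y)) \<le> ln (\<eta> x * exp (u x))"
      using x(2)[of y] y pos[OF y] pos[OF xb] by simp
    then show "ln (\<eta> y) + u y \<le> ln (\<eta> x) + u x"
      using pos[OF y] pos[OF xb] by (simp add: ln_mult)
  qed
  moreover have "(norm (- 2 *\<^sub>R (x - a)))\<^sup>2 = 4 * (r\<^sup>2 - \<eta> x)" by (simp add: \<eta>_def power_mult_distrib)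
  ultimately have "exp (2 * u x) \<le> 4 * r\<^sup>2 / (\<eta> x)\<^sup>2"
    using pos[OF xb] by (simp add: field_simps power2_eq_square)
  then have "(\<eta> x * exp (u x))\<^sup>2 \<le> (2 * r)\<^sup>2"
    using pos[OF xb] unfolding exp_double by (simp add: power_mult_distrib pos_le_divide_eq mult.commute)
  then have "\<eta> x * exp (u x) \<le> 2 * r" by (rule power2_le_imp_le) (use r in simp)
  then have "r\<^sup>2 * exp (u a) \<le> 2 * r" using x(2)[of a] r by (simp add: \<eta>_def)
  then have "exp (u a) \<le> 2 / r" using r by (simp add: power2_eq_square field_simps)
  then show ?thesis using r by (simp add: ln_ge_iff)
qed

section \<open>Iterated partial derivatives\<close>

text \<open>The increment is split into a vertical and a horizontal step; on each, the mean value inequality is applied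
to \<open>f\<close> minus its linear approximation at \<open>z\<close>.\<close>
lemma GDERIV_of_continuous_partials:
  fixes f :: "complex \<Rightarrow> real"
  assumes S: "open S" "z \<in> S"
    and d: "\<And>b w. b \<in> Basis \<Longrightarrow> w \<in> S \<Longrightarrow> (\<lambda>t. f (w + t *\<^sub>R b)) differentiable (at 0)"
    and c: "\<And>b. b \<in> Basis \<Longrightarrow> continuous_on S (partial_deriv b f)"
  shows "GDERIV f z :> (\<Sum>b\<in>Basis. partial_deriv b f z *\<^sub>R b)"
proof -
  have line: "DERIV (\<lambda>t. f (w + t *\<^sub>R b)) t :> partial_deriv b f (w + t *\<^sub>R b)"
    if "b \<in> Basis" "w + t *\<^sub>R b \<in> S" for b w t
  proof -
    have "DERIV (\<lambda>s. f ((w + t *\<^sub>R b) + s *\<^sub>R b)) 0 :> partial_deriv b f (w + t *\<^sub>R b)"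
      unfolding partial_deriv_def using d[OF that] by (simp add: DERIV_deriv_iff_real_differentiable)
    then have "DERIV (\<lambda>s. f (w + (s + t) *\<^sub>R b)) 0 :> partial_deriv b f (w + t *\<^sub>R b)"
      by (simp add: scaleR_add_left add_ac)
    then show ?thesis using DERIV_shift[of "\<lambda>s. f (w + s *\<^sub>R b)" _ 0 t] by simp
  qed
  let ?p = "partial_deriv 1 f" and ?q = "partial_deriv \<i> f"
  have grad: "(\<Sum>b\<in>Basis. partial_deriv b f z *\<^sub>R b) = Complex (?p z) (?q z)"
    by (simp add: Basis_complex_def complex_eq_iff)
  have inner: "h \<bullet> Complex (?p z) (?q z) = Re h * ?p z + Im h * ?q z" for h
    by (simp add: inner_complex_def)
  show ?thesis
    unfolding gderiv_def grad inner has_derivative_at_alt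
  proof (intro conjI allI impI)
    show "bounded_linear (\<lambda>h. Re h * ?p z + Im h * ?q z)"
      by (intro bounded_linear_intros bounded_linear_Re bounded_linear_Im)
    fix e :: real assume e: "e > 0"
    obtain d0 where d0: "d0 > 0" "ball z d0 \<subseteq> S" using S openE by blast
    have "isCont ?p z" "isCont ?q z"
      using c[of 1] c[of \<i>] S by (auto simp: Basis_complex_def continuous_on_eq_continuous_at)
    then obtain d1 d2 where d1: "d1 > 0" "\<And>y. dist y z < d1 \<Longrightarrow> \<bar>?p y - ?p z\<bar> < e/2"
      and d2: "d2 > 0" "\<And>y. dist y z < d2 \<Longrightarrow> \<bar>?q y - ?q z\<bar> < e/2"
      using e unfolding continuous_at_eps_delta dist_real_def by (metis half_gt_zero)
    define d where "d = min d0 (min d1 d2)"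
    have "d > 0" using d0 d1 d2 by (simp add: d_def)
    moreover have "norm (f y - f z - (Re (y - z) * ?p z + Im (y - z) * ?q z)) \<le> e * norm (y - z)"
      if y: "norm (y - z) < d" for y
    proof -
      define s t where "s = Re (y - z)" and "t = Im (y - z)"
      have st: "\<bar>s\<bar> \<le> norm (y - z)" "\<bar>t\<bar> \<le> norm (y - z)" unfolding s_def t_def
        by (rule abs_Re_le_cmod abs_Im_le_cmod)+
      define z' where "z' = z + t *\<^sub>R \<i>"
      have y_eq: "y = z' + s *\<^sub>R 1" by (simp add: z'_def s_def t_def complex_eq_iff)
      have close: "dist (z' + x *\<^sub>R 1) z < d" if "x \<in> closed_segment 0 s" for x
      proof -
        have "\<bar>x\<bar> \<le> \<bar>s\<bar>" using that by (auto simp: closed_segment_eq_real_ivl split: if_splits)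
        moreover have "z' + x *\<^sub>R 1 - z = Complex x t" by (simp add: z'_def complex_eq_iff)
        moreover have "y - z = Complex s t" by (simp add: s_def t_def complex_eq_iff)
        ultimately have "norm (z' + x *\<^sub>R 1 - z) \<le> norm (y - z)"
          by (auto simp: complex_norm power2_le_iff_abs_le intro!: real_sqrt_le_mono abs_le_square_iff[THEN iffD1])
        then show ?thesis using y by (simp add: dist_norm)
      qed
      have close': "dist (z + x *\<^sub>R \<i>) z < d" if "x \<in> closed_segment 0 t" for x
      proof -
        have "\<bar>x\<bar> \<le> \<bar>t\<bar>" using that by (auto simp: closed_segment_eq_real_ivl split: if_splits)
        then show ?thesis using st y by (simp add: dist_norm norm_mult)
      qed
      have "norm ((f (z' + s *\<^sub>R 1) - s * ?p z) - (f (z' + 0 *\<^sub>R 1) - 0 * ?p z)) \<le> e/2 * norm (s - 0)"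
      proof (rule field_differentiable_bound[where S = "closed_segment 0 s" and f = "\<lambda>x. f (z' + x *\<^sub>R 1) - x * ?p z"])
        fix x assume x: "x \<in> closed_segment 0 s"
        have "z' + x *\<^sub>R 1 \<in> S" using close[OF x] d0 by (auto simp: d_def subset_iff dist_commute)
        from line[of 1 z' x, OF _ this]
        have "DERIV (\<lambda>x. f (z' + x *\<^sub>R 1) - x * ?p z) x :> ?p (z' + x *\<^sub>R 1) - ?p z"
          by (auto intro!: derivative_eq_intros simp: Basis_complex_def)
        then show "((\<lambda>x. f (z' + x *\<^sub>R 1) - x * ?p z) has_real_derivative ?p (z' + x *\<^sub>R 1) - ?p z) (at x within closed_segment 0 s)"
          by (rule has_field_derivative_at_within)
        show "norm (?p (z' + x *\<^sub>R 1) - ?p z) \<le> e/2"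
          using d1(2) close[OF x] by (simp add: d_def less_imp_le)
      qed auto
      moreover have "norm ((f (z + t *\<^sub>R \<i>) - t * ?q z) - (f (z + 0 *\<^sub>R \<i>) - 0 * ?q z)) \<le> e/2 * norm (t - 0)"
      proof (rule field_differentiable_bound[where S = "closed_segment 0 t" and f = "\<lambda>x. f (z + x *\<^sub>R \<i>) - x * ?q z"])
        fix x assume x: "x \<in> closed_segment 0 t"
        have "z + x *\<^sub>R \<i> \<in> S" using close'[OF x] d0 by (auto simp: d_def subset_iff dist_commute)
        from line[of \<i> z x, OF _ this]
        have "DERIV (\<lambda>x. f (z + x *\<^sub>R \<i>) - x * ?q z) x :> ?q (z + x *\<^sub>R \<i>) - ?q z"
          by (auto intro!: derivative_eq_intros simp: Basis_complex_def)
        then show "((\<lambda>x. f (z + x *\<^sub>R \<i>) - x * ?q z) has_real_derivative ?q (z + x *\<^sub>R \<i>) - ?q z) (at x within closed_segment 0 t)"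
          by (rule has_field_derivative_at_within)
        show "norm (?q (z + x *\<^sub>R \<i>) - ?q z) \<le> e/2"
          using d2(2) close'[OF x] by (simp add: d_def less_imp_le)
      qed auto
      ultimately have "\<bar>f y - f z' - s * ?p z\<bar> \<le> e/2 * \<bar>s\<bar>" "\<bar>f z' - f z - t * ?q z\<bar> \<le> e/2 * \<bar>t\<bar>"
        by (auto simp: y_eq z'_def algebra_simps)
      moreover have "e/2 * \<bar>s\<bar> \<le> e/2 * norm (y - z)" "e/2 * \<bar>t\<bar> \<le> e/2 * norm (y - z)"
        using st e by (auto intro!: mult_left_mono)
      ultimately show ?thesis unfolding s_def[symmetric] t_def[symmetric] real_norm_def by linarith
    qed
    ultimately show "\<exists>d>0. \<forall>y. norm (y - z) < d \<longrightarrow> norm (f y - f z - (Re (y - z) * ?p z + Im (y - z) * ?q z)) \<le> e * norm (y - z)"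
      by blast
  qed
qed

lemma has_hessian_on_of_Ck2:
  fixes f :: "complex \<Rightarrow> real"
  assumes S: "open S" and f: "Ck_on 2 f S"
  obtains g H where "has_hessian_on f g H S" "continuous_on S g" "\<And>h. continuous_on S (\<lambda>z. H z h)"
proof -
  define gr where "gr f z = (\<Sum>b\<in>Basis. partial_deriv b f z *\<^sub>R b)" for f :: "complex \<Rightarrow> real" and z :: complex
  define H where "H z h = (\<Sum>b\<in>Basis. (h \<bullet> gr (partial_deriv b f) z) *\<^sub>R b)" for z h :: complex
  have f': "continuous_on S f"
    "\<And>b z. b \<in> Basis \<Longrightarrow> z \<in> S \<Longrightarrow> (\<lambda>t. f (z + t *\<^sub>R b)) differentiable (at 0)"
    "\<And>b. b \<in> Basis \<Longrightarrow> continuous_on S (partial_deriv b f)"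
    "\<And>b c z. b \<in> Basis \<Longrightarrow> c \<in> Basis \<Longrightarrow> z \<in> S \<Longrightarrow> (\<lambda>t. partial_deriv b f (z + t *\<^sub>R c)) differentiable (at 0)"
    "\<And>b c. b \<in> Basis \<Longrightarrow> c \<in> Basis \<Longrightarrow> continuous_on S (partial_deriv c (partial_deriv b f))"
    using f by (auto simp: numeral_2_eq_2)
  have 1: "GDERIV f z :> gr f z" if "z \<in> S" for z
    unfolding gr_def by (rule GDERIV_of_continuous_partials[OF S that f'(2,3)])
  have 2: "GDERIV (partial_deriv b f) z :> gr (partial_deriv b f) z" if "z \<in> S" "b \<in> Basis" for z b
    unfolding gr_def by (rule GDERIV_of_continuous_partials[OF S that(1) f'(4,5)[OF that(2)]])
  have "(gr f has_derivative H z) (at z)" if "z \<in> S" for z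
  proof -
    have "((\<lambda>z. \<Sum>b\<in>Basis. partial_deriv b f z *\<^sub>R b) has_derivative (\<lambda>h. \<Sum>b\<in>Basis. (h \<bullet> gr (partial_deriv b f) z) *\<^sub>R b)) (at z)"
      using 2[OF that] unfolding gderiv_def
      by (intro has_derivative_sum has_derivative_scaleR_left) auto
    then show ?thesis unfolding H_def gr_def .
  qed
  then have "has_hessian_on f (gr f) H S" using 1 by (simp add: has_hessian_on_def)
  moreover have "continuous_on S (gr f)" unfolding gr_def using f' by (intro continuous_intros) auto
  moreover have "continuous_on S (\<lambda>z. H z h)" for h
    unfolding H_def gr_def using f' by (intro continuous_intros) auto
  ultimately show ?thesis using that by blast
qed

lemma DERIV_line_cong:
  fixes S :: "'a::real_normed_vector set"
  assumes S: "open S" "z \<in> S" and eq: "\<And>w. w \<in> S \<Longrightarrow> f w = f' w"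
    and d: "DERIV (\<lambda>t. f (z + t *\<^sub>R b)) 0 :> D"
  shows "DERIV (\<lambda>t. f' (z + t *\<^sub>R b)) 0 :> D"
proof (rule has_field_derivative_transform_within_open[OF d])
  show "open ((\<lambda>t. z + t *\<^sub>R b) -` S)"
    by (intro open_vimage S(1)) (auto intro!: continuous_intros)
qed (use S eq in auto)

lemma Ck2_of_has_hessian_on:
  assumes S: "open S" and f: "has_hessian_on f g H S"
    and H: "\<And>b. b \<in> Basis \<Longrightarrow> continuous_on S (\<lambda>z. H z b)"
  shows "Ck_on 2 f S" and "\<And>z. z \<in> S \<Longrightarrow> laplacian f z = trace_of (H z)"
proof -
  have g1: "DERIV (\<lambda>t. f (z + t *\<^sub>R b)) 0 :> g z \<bullet> b" if "z \<in> S" for z b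
    using f that unfolding has_hessian_on_def by (intro GDERIV_line) auto
  have p1: "partial_deriv b f z = g z \<bullet> b" if "z \<in> S" for z b
    unfolding partial_deriv_def using g1[OF that] by (rule DERIV_imp_deriv)
  have g2: "DERIV (\<lambda>t. partial_deriv b f (z + t *\<^sub>R c)) 0 :> H z c \<bullet> b" if z: "z \<in> S" for z b c
  proof (rule DERIV_line_cong[OF S z p1[symmetric]])
    have D: "(g has_derivative H z) (at (z + 0 *\<^sub>R c))" using f z by (simp add: has_hessian_on_def)
    have "((\<lambda>t. z + t *\<^sub>R c) has_derivative (\<lambda>t. t *\<^sub>R c)) (at 0)"
      by (auto intro!: derivative_eq_intros)
    from has_derivative_compose[OF this D]
    have "((\<lambda>t. g (z + t *\<^sub>R c) \<bullet> b) has_derivative (\<lambda>t. H z (t *\<^sub>R c) \<bullet> b)) (at 0)"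
      by (auto intro!: derivative_eq_intros)
    moreover have "linear (H z)" using D by (simp add: has_derivative_linear)
    ultimately show "DERIV (\<lambda>t. g (z + t *\<^sub>R c) \<bullet> b) 0 :> H z c \<bullet> b"
      by (simp add: has_field_derivative_def linear_cmul mult_commute_abs)
  qed
  have p2: "partial_deriv c (partial_deriv b f) z = H z c \<bullet> b" if "z \<in> S" for z b c
    unfolding partial_deriv_def[of c] using g2[OF that] by (rule DERIV_imp_deriv)
  have cont: "continuous_on S f" "continuous_on S g"
    using f unfolding has_hessian_on_def gderiv_def
    by (meson continuous_at_imp_continuous_on has_derivative_continuous)+
  have cp1: "continuous_on S (partial_deriv b f)" for b
  proof -
    have "continuous_on S (\<lambda>z. g z \<bullet> b)" by (intro continuous_intros cont)
    then show ?thesis using p1 by (simp cong: continuous_on_cong)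
  qed
  have cp2: "continuous_on S (partial_deriv c (partial_deriv b f))" if "c \<in> Basis" for b c
  proof -
    have "continuous_on S (\<lambda>z. H z c \<bullet> b)" by (intro continuous_intros H that)
    then show ?thesis using p2 by (simp cong: continuous_on_cong)
  qed
  have d1: "(\<lambda>t. f (z + t *\<^sub>R b)) differentiable (at 0)" if "z \<in> S" for z b
    using g1[OF that] unfolding real_differentiable_def by blast
  have d2: "(\<lambda>t. partial_deriv b f (z + t *\<^sub>R c)) differentiable (at 0)" if "z \<in> S" for z b c
    using g2[OF that] unfolding real_differentiable_def by blast
  show "Ck_on 2 f S"
    using cont cp1 cp2 d1 d2 by (auto simp: numeral_2_eq_2)
  show "laplacian f z = trace_of (H z)" if "z \<in> S" for z
    using p2[OF that] by (simp add: laplacian_def trace_of_def)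
qed

lemma has_hessian_on_eq:
  assumes S: "open S" and f: "has_hessian_on f g H S" and eq: "\<And>z. z \<in> S \<Longrightarrow> f z = f' z"
  shows "has_hessian_on f' g H S"
  unfolding has_hessian_on_def gderiv_def
  using f eq S unfolding has_hessian_on_def gderiv_def
  by (auto intro: has_derivative_transform_within_open)

section \<open>Solutions of Liouville's equation and their holomorphic quadratic differential\<close>

text \<open>The general symmetric real-linear map of the plane with trace \<open>E\<close>, with its antilinear coefficient
parametrised so that \<open>k\<close> becomes holomorphic when \<open>E = exp (2u)\<close> and \<open>g\<close> is the gradient of a solution \<open>u\<close>.\<close>
definition liouville_hessian :: "real \<Rightarrow> complex \<Rightarrow> complex \<Rightarrow> complex \<Rightarrow> complex" where
  "liouville_hessian E g k h = (E / 2) *\<^sub>R h + (cnj k + g\<^sup>2 / 2) * cnj h"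

text \<open>The Laplacian of \<open>u\<close> is the trace \<open>exp (2u)\<close> of the prescribed Hessian. The gradient \<open>g\<close> and the quadratic
differential \<open>k\<close> are carried along because the estimates concern them.\<close>
definition liouville_solution_on ::
    "(complex \<Rightarrow> real) \<Rightarrow> (complex \<Rightarrow> complex) \<Rightarrow> (complex \<Rightarrow> complex) \<Rightarrow> complex set \<Rightarrow> bool" where
  "liouville_solution_on u g k S \<longleftrightarrow> open S \<and> k holomorphic_on S \<and>
     has_hessian_on u g (\<lambda>z. liouville_hessian (exp (2 * u z)) (g z) (k z)) S"

lemma trace_of_complex: "trace_of D = Re (D 1) + Im (D \<i>)"
  by (simp add: trace_of_def Basis_complex_def)

lemma symmetric_complex_map:
  fixes D :: "complex \<Rightarrow> complex"
  assumes "linear D" and sym: "\<And>v w. D v \<bullet> w = D w \<bullet> v"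
  shows "D h = (trace_of D / 2) *\<^sub>R h + (D 1 - of_real (trace_of D / 2)) * cnj h"
proof -
  have "D h = D (Re h *\<^sub>R 1 + Im h *\<^sub>R \<i>)" by (rule arg_cong[where f = D]) (simp add: complex_eq_iff)
  also have "\<dots> = Re h *\<^sub>R D 1 + Im h *\<^sub>R D \<i>"
    using assms(1) by (simp only: linear_add linear_cmul)
  finally have D: "D h = Re h *\<^sub>R D 1 + Im h *\<^sub>R D \<i>" .
  have "Re (D \<i>) = Im (D 1)" using sym[of 1 \<i>] by simp
  then show ?thesis unfolding D trace_of_complex by (simp add: complex_eq_iff field_simps)
qed

text \<open>With \<open>E = exp (2u)\<close>, the two maps are the derivatives of \<open>(g\<^sup>2 + E)/2\<close> and \<open>\<i>(g\<^sup>2 - E)/2\<close>, the vector fields that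
represent the real and the imaginary part of the form \<open>w\<^sup>2/2 dz + E/2 d(cnj z)\<close>, \<open>w = cnj g\<close>. Their symmetry is the
closedness of this form; it holds for every antilinear coefficient \<open>c\<close> because \<open>v \<mapsto> c (cnj v)\<close> is symmetric for
every \<open>c\<close>, and the linear coefficient \<open>E/2\<close> is what Liouville's equation provides.\<close>
lemma liouville_form_symmetric:
  fixes g c v w :: complex and E :: real
  defines "D \<equiv> \<lambda>h. (E / 2) *\<^sub>R h + c * cnj h"
  shows "(g * D v + of_real (E * (v \<bullet> g))) \<bullet> w = (g * D w + of_real (E * (w \<bullet> g))) \<bullet> v"
    and "(\<i> * (g * D v - of_real (E * (v \<bullet> g)))) \<bullet> w = (\<i> * (g * D w - of_real (E * (w \<bullet> g)))) \<bullet> v"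
  unfolding D_def by (simp_all add: inner_complex_def algebra_simps)

text \<open>Since \<open>dw = (k + w\<^sup>2/2) dz + E/2 d(cnj z)\<close> for \<open>w = cnj g\<close>, subtracting from \<open>w\<close> a primitive of the closed form
\<open>w\<^sup>2/2 dz + E/2 d(cnj z)\<close> leaves a function \<open>\<Phi>\<close> with \<open>d\<Phi> = k dz\<close>. So \<open>k\<close> is locally the derivative of a
holomorphic function. Only second derivatives of \<open>u\<close> enter; differentiating \<open>k\<close> directly would take three.\<close>
lemma liouville_quadratic_differential_holomorphic:
  assumes S: "open S"
    and u: "has_hessian_on u g (\<lambda>z. liouville_hessian (exp (2 * u z)) (g z) (k z)) S"
    and k: "continuous_on S k"
  shows "k holomorphic_on S"
proof -
  define D where "D z = liouville_hessian (exp (2 * u z)) (g z) (k z)" for z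
  have du: "(u has_derivative (\<lambda>h. h \<bullet> g z)) (at z)" and dg: "(g has_derivative D z) (at z)" if "z \<in> S" for z
    using u that unfolding has_hessian_on_def gderiv_def D_def by auto
  have cu: "continuous_on S u" and cg: "continuous_on S g"
    using du dg by (meson continuous_at_imp_continuous_on has_derivative_continuous)+
  have "k field_differentiable (at a)" if a: "a \<in> S" for a
  proof -
    obtain r where r: "r > 0" "ball a r \<subseteq> S" using S a openE by blast
    \<comment> \<open>The vector fields that represent the real and the imaginary part of \<open>w\<^sup>2/2 dz + exp (2u)/2 d(cnj z)\<close>.\<close>
    define X where "X z = ((g z)\<^sup>2 + of_real (exp (2 * u z))) / 2" for z
    define Y where "Y z = \<i> * ((g z)\<^sup>2 - of_real (exp (2 * u z))) / 2" for z
    define X' where "X' z h = g z * D z h + of_real (exp (2 * u z) * (h \<bullet> g z))" for z h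
    define Y' where "Y' z h = \<i> * (g z * D z h - of_real (exp (2 * u z) * (h \<bullet> g z)))" for z h
    have dX: "(X has_derivative X' z) (at z)" and dY: "(Y has_derivative Y' z) (at z)" if "z \<in> S" for z
      unfolding X_def[abs_def] Y_def[abs_def] X'_def[abs_def] Y'_def[abs_def]
      by (auto intro!: derivative_eq_intros dg[OF that] du[OF that] simp: fun_eq_iff field_simps)
    have cX': "continuous_on (ball a r \<times> UNIV) (\<lambda>(z, h). X' z h)"
      and cY': "continuous_on (ball a r \<times> UNIV) (\<lambda>(z, h). Y' z h)"
      unfolding case_prod_unfold X'_def Y'_def D_def liouville_hessian_def
      using r by (intro continuous_intros continuous_on_compose2[OF cu] continuous_on_compose2[OF cg]
          continuous_on_compose2[OF k]; auto)+
    obtain F1 where F1: "\<And>z. z \<in> ball a r \<Longrightarrow> GDERIV F1 z :> X z"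
    proof (rule symmetric_field_has_potential[of "ball a r" a X X'])
      show "X' x v \<bullet> w = X' x w \<bullet> v" for x v w
        unfolding X'_def D_def liouville_hessian_def by (rule liouville_form_symmetric)
    qed (use r dX cX' in auto)
    obtain F2 where F2: "\<And>z. z \<in> ball a r \<Longrightarrow> GDERIV F2 z :> Y z"
    proof (rule symmetric_field_has_potential[of "ball a r" a Y Y'])
      show "Y' x v \<bullet> w = Y' x w \<bullet> v" for x v w
        unfolding Y'_def D_def liouville_hessian_def by (rule liouville_form_symmetric)
    qed (use r dY cY' in auto)
    define \<Phi> where "\<Phi> z = cnj (g z) - (of_real (F1 z) + \<i> * of_real (F2 z))" for z
    have \<Phi>: "(\<Phi> has_field_derivative k z) (at z)" if z: "z \<in> ball a r" for z
    proof -
      have "(\<Phi> has_derivative (\<lambda>h. cnj (D z h) - (of_real (h \<bullet> X z) + \<i> * of_real (h \<bullet> Y z)))) (at z)"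
        unfolding \<Phi>_def using F1[OF z] F2[OF z] dg z r unfolding gderiv_def
        by (auto intro!: derivative_eq_intros)
      moreover have "cnj (D z h) - (of_real (h \<bullet> X z) + \<i> * of_real (h \<bullet> Y z)) = k z * h" for h
        unfolding D_def liouville_hessian_def X_def Y_def
        by (simp add: complex_eq_iff inner_complex_def power2_eq_square field_simps)
      ultimately show ?thesis by (simp add: has_field_derivative_def)
    qed
    have "\<Phi> holomorphic_on ball a r"
      unfolding holomorphic_on_open[OF open_ball] using \<Phi> by blast
    then have "deriv \<Phi> holomorphic_on ball a r" by (rule holomorphic_deriv) simp
    moreover have "deriv \<Phi> z = k z" if "z \<in> ball a r" for z using \<Phi>[OF that] by (rule DERIV_imp_deriv)
    ultimately have "k holomorphic_on ball a r" by (rule holomorphic_transform)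
    then show ?thesis using r by (simp add: holomorphic_on_imp_differentiable_at)
  qed
  then show ?thesis by (simp add: holomorphic_on_def field_differentiable_at_within)
qed

lemma liouville_solutionI:
  fixes u :: "complex \<Rightarrow> real"
  assumes S: "open S" and u: "has_hessian_on u g H S" and trace: "\<And>z. z \<in> S \<Longrightarrow> trace_of (H z) = exp (2 * u z)"
    and H: "continuous_on S (\<lambda>z. H z 1)"
  obtains k where "liouville_solution_on u g k S"
proof
  \<comment> \<open>The antilinear coefficient of \<open>H z\<close> is \<open>H z 1 - exp (2u)/2\<close>; it has to equal \<open>cnj k + g\<^sup>2/2\<close>.\<close>
  define k where "k z = cnj (H z 1) - of_real (exp (2 * u z) / 2) - (cnj (g z))\<^sup>2 / 2" for z
  have du: "(u has_derivative (\<lambda>h. h \<bullet> g z)) (at z)" and dg: "(g has_derivative H z) (at z)" if "z \<in> S" for z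
    using u that unfolding has_hessian_on_def gderiv_def by auto
  have cont: "continuous_on S u" "continuous_on S g"
    using du dg by (meson continuous_at_imp_continuous_on has_derivative_continuous)+
  have ck: "continuous_on S k" unfolding k_def by (intro continuous_intros cont H) auto
  have "H z = liouville_hessian (exp (2 * u z)) (g z) (k z)" if z: "z \<in> S" for z
  proof
    fix h
    have "linear (H z)" using dg[OF z] by (rule has_derivative_linear)
    moreover have "H z v \<bullet> w = H z w \<bullet> v" for v w
      using u by (intro hessian_symmetric[OF S z _ dg[OF z]]) (auto simp: has_hessian_on_def)
    ultimately show "H z h = liouville_hessian (exp (2 * u z)) (g z) (k z) h"
      using symmetric_complex_map[of "H z" h] trace[OF z]
      by (simp add: liouville_hessian_def k_def)
  qed
  then have h: "has_hessian_on u g (\<lambda>z. liouville_hessian (exp (2 * u z)) (g z) (k z)) S"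
    using u by (simp add: has_hessian_on_def)
  then show "liouville_solution_on u g k S"
    using liouville_quadratic_differential_holomorphic[OF S h ck] S by (simp add: liouville_solution_on_def)
qed

section \<open>Interior estimates\<close>

lemma liouville_solutionD:
  assumes "liouville_solution_on u g k S" "z \<in> S"
  shows "(u has_derivative (\<lambda>h. h \<bullet> g z)) (at z)"
    "(g has_derivative liouville_hessian (exp (2 * u z)) (g z) (k z)) (at z)"
    "(k has_derivative (\<lambda>h. deriv k z * h)) (at z)"
proof -
  have "open S" "k holomorphic_on S" using assms(1) by (auto simp: liouville_solution_on_def)
  then show "(k has_derivative (\<lambda>h. deriv k z * h)) (at z)"
    using holomorphic_derivI assms(2) by (auto simp: has_field_derivative_def)
qed (use assms in \<open>auto simp: liouville_solution_on_def has_hessian_on_def gderiv_def\<close>)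

lemma liouville_solution_continuous:
  assumes "liouville_solution_on u g k S"
  shows "continuous_on S u" "continuous_on S g" "continuous_on S k"
  using liouville_solutionD[OF assms]
  by (meson continuous_at_imp_continuous_on has_derivative_continuous)+

lemma trace_of_liouville_hessian: "trace_of (liouville_hessian E g k) = E"
  by (simp add: trace_of_complex liouville_hessian_def)

lemma liouville_solution_laplacian:
  assumes "liouville_solution_on u g k S"
  shows "has_laplacian_on u g (\<lambda>z. exp (2 * u z)) S"
  using assms unfolding liouville_solution_on_def has_laplacian_on_def
  by (auto simp: trace_of_liouville_hessian)

text \<open>This needs third derivatives of \<open>u\<close>, which the formula for the Hessian supplies because \<open>k\<close> is differentiable.
The derivative of \<open>k\<close> does not show up in the Laplacian: it enters through an antilinear map, which has trace \<open>0\<close>.\<close>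
lemma laplacian_gradient_sq:
  assumes "liouville_solution_on u g k S"
  defines "E \<equiv> \<lambda>z. exp (2 * u z)" and "c \<equiv> \<lambda>z. cnj (k z) + (g z)\<^sup>2 / 2"
  shows "has_laplacian_on (\<lambda>z. (norm (g z))\<^sup>2) (\<lambda>z. E z *\<^sub>R g z + 2 * c z * cnj (g z))
     (\<lambda>z. 4 * E z * (norm (g z))\<^sup>2 + (E z)\<^sup>2 + 4 * (norm (c z))\<^sup>2) S"
proof -
  define D where "D z = liouville_hessian (E z) (g z) (k z)" for z
  define K where "K z h = E z *\<^sub>R D z h + (E z * (2 * (h \<bullet> g z))) *\<^sub>R g z
    + (2 * c z * cnj (D z h) + 2 * (cnj (deriv k z * h) + g z * D z h) * cnj (g z))" for z h
  have D: "D z h = (E z / 2) *\<^sub>R h + c z * cnj h" for z h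
    by (simp add: D_def c_def liouville_hessian_def)
  show ?thesis
  proof (rule has_laplacian_onI[where H = K])
    fix z assume z: "z \<in> S"
    note d = liouville_solutionD[OF assms(1) z]
    have dg: "(g has_derivative D z) (at z)" using d(2) by (simp add: D_def E_def)
    have "((\<lambda>z. (norm (g z))\<^sup>2) has_derivative (\<lambda>h. 2 * (D z h \<bullet> g z))) (at z)"
      unfolding power2_norm_eq_inner by (auto intro!: derivative_eq_intros dg simp: inner_commute)
    moreover have "2 * (D z h \<bullet> g z) = h \<bullet> (E z *\<^sub>R g z + 2 * c z * cnj (g z))" for h
      by (simp add: D inner_complex_def algebra_simps)
    ultimately show "GDERIV (\<lambda>z. (norm (g z))\<^sup>2) z :> E z *\<^sub>R g z + 2 * c z * cnj (g z)"
      unfolding gderiv_def by simp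
    have dE: "(E has_derivative (\<lambda>h. E z * (2 * (h \<bullet> g z)))) (at z)"
      unfolding E_def by (auto intro!: derivative_eq_intros d(1))
    have dc: "(c has_derivative (\<lambda>h. cnj (deriv k z * h) + g z * D z h)) (at z)"
      unfolding c_def by (auto intro!: derivative_eq_intros d(3) dg simp: fun_eq_iff field_simps)
    show "((\<lambda>z. E z *\<^sub>R g z + 2 * c z * cnj (g z)) has_derivative K z) (at z)"
      unfolding K_def by (auto intro!: derivative_eq_intros dE dc dg simp: fun_eq_iff algebra_simps)
    show "trace_of (K z) = 4 * E z * (norm (g z))\<^sup>2 + (E z)\<^sup>2 + 4 * (norm (c z))\<^sup>2"
      unfolding K_def D cmod_power2
      by (simp add: trace_of_complex inner_complex_def power2_eq_square algebra_simps)
  qed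
qed

lemma laplacian_norm_sq_holomorphic:
  assumes k: "k holomorphic_on S" and S: "open S"
  shows "has_laplacian_on (\<lambda>z. (norm (k z))\<^sup>2) (\<lambda>z. 2 * k z * cnj (deriv k z))
     (\<lambda>z. 4 * (norm (deriv k z))\<^sup>2) S"
proof (rule has_laplacian_onI[where H = "\<lambda>z h. 2 * k z * cnj (deriv (deriv k) z * h) + 2 * (deriv k z * h) * cnj (deriv k z)"])
  fix z assume z: "z \<in> S"
  have d: "(k has_derivative (\<lambda>h. deriv k z * h)) (at z)"
    "(deriv k has_derivative (\<lambda>h. deriv (deriv k) z * h)) (at z)"
    using holomorphic_derivI[OF k S z] holomorphic_derivI[OF holomorphic_deriv[OF k S] S z]
    by (auto simp: has_field_derivative_def)
  have "((\<lambda>z. (norm (k z))\<^sup>2) has_derivative (\<lambda>h. 2 * ((deriv k z * h) \<bullet> k z))) (at z)"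
    unfolding power2_norm_eq_inner by (auto intro!: derivative_eq_intros d simp: inner_commute)
  moreover have "2 * ((deriv k z * h) \<bullet> k z) = h \<bullet> (2 * k z * cnj (deriv k z))" for h
    by (simp add: inner_complex_def algebra_simps)
  ultimately show "GDERIV (\<lambda>z. (norm (k z))\<^sup>2) z :> 2 * k z * cnj (deriv k z)"
    unfolding gderiv_def by simp
  show "((\<lambda>z. 2 * k z * cnj (deriv k z)) has_derivative
     (\<lambda>h. 2 * k z * cnj (deriv (deriv k) z * h) + 2 * (deriv k z * h) * cnj (deriv k z))) (at z)"
    by (auto intro!: derivative_eq_intros d simp: fun_eq_iff algebra_simps)
  show "trace_of (\<lambda>h. 2 * k z * cnj (deriv (deriv k) z * h) + 2 * (deriv k z * h) * cnj (deriv k z))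
     = 4 * (norm (deriv k z))\<^sup>2"
    unfolding cmod_power2 by (simp add: trace_of_complex power2_eq_square algebra_simps)
qed

lemma laplacian_shifted_sq:
  assumes u: "has_laplacian_on u g L S"
  shows "has_laplacian_on (\<lambda>z. (u z - m)\<^sup>2) (\<lambda>z. (2 * (u z - m)) *\<^sub>R g z)
     (\<lambda>z. 2 * (u z - m) * L z + 2 * (norm (g z))\<^sup>2) S"
  by (rule has_laplacian_on_compose[OF u, where \<phi> = "\<lambda>t. (t - m)\<^sup>2" and \<phi>' = "\<lambda>t. 2 * (t - m)" and \<phi>'' = "\<lambda>_. 2"])
    (auto intro!: derivative_eq_intros)

text \<open>Bernstein's method with \<open>Q = \<bar>g\<bar>\<^sup>2\<close>. The choice \<open>W = 12 r\<^sup>2 (u - m)\<^sup>2\<close> works because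
\<open>\<Delta>(u - m)\<^sup>2 = 2 \<bar>g\<bar>\<^sup>2 + 2 (u - m) exp (2u)\<close> and the last term is nonnegative.\<close>
lemma gradient_estimate:
  assumes sol: "liouville_solution_on u g k S" and r: "r > 0" "cball a r \<subseteq> S"
    and bound: "\<And>z. z \<in> cball a r \<Longrightarrow> m \<le> u z" "\<And>z. z \<in> cball a r \<Longrightarrow> u z \<le> M"
  shows "(norm (g a))\<^sup>2 \<le> 12 * (M - m)\<^sup>2 / r\<^sup>2"
proof -
  have sub: "ball a r \<subseteq> S" using r by auto
  note cont = liouville_solution_continuous[OF sol, THEN continuous_on_subset, OF r(2)]
  have W: "has_laplacian_on (\<lambda>z. (12 * r\<^sup>2) * (u z - m)\<^sup>2) (\<lambda>z. (12 * r\<^sup>2) *\<^sub>R ((2 * (u z - m)) *\<^sub>R g z))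
     (\<lambda>z. (12 * r\<^sup>2) * (2 * (u z - m) * exp (2 * u z) + 2 * (norm (g z))\<^sup>2)) (ball a r)"
    by (intro has_laplacian_on_cmult laplacian_shifted_sq
        has_laplacian_on_subset[OF liouville_solution_laplacian[OF sol] sub])
  have "r ^ 4 * (norm (g a))\<^sup>2 \<le> 12 * r\<^sup>2 * (M - m)\<^sup>2"
  proof (rule bernstein_estimate[OF r(1) has_laplacian_on_subset[OF laplacian_gradient_sq[OF sol] sub] _ W])
    fix z assume z: "z \<in> ball a r"
    define E where "E = exp (2 * u z)"
    define c where "c = cnj (k z) + (g z)\<^sup>2 / 2"
    define n where "n = norm (g z)"
    have E: "E > 0" by (simp add: E_def)
    have n0: "n \<ge> 0" by (simp add: n_def)
    have "norm (E *\<^sub>R g z + 2 * c * cnj (g z)) \<le> E * n + 2 * norm c * n"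
      by (rule norm_triangle_le) (simp add: norm_mult n_def E less_imp_le)
    then have "(norm (E *\<^sub>R g z + 2 * c * cnj (g z)))\<^sup>2 \<le> (E * n + 2 * norm c * n)\<^sup>2"
      by (intro power_mono) auto
    also have "\<dots> = 2 * n\<^sup>2 * (E\<^sup>2 + 4 * (norm c)\<^sup>2) - (n * (E - 2 * norm c))\<^sup>2" by algebra
    also have "\<dots> \<le> 2 * n\<^sup>2 * (E\<^sup>2 + 4 * (norm c)\<^sup>2)" by simp
    also have "\<dots> \<le> 2 * n\<^sup>2 * (4 * E * n\<^sup>2 + E\<^sup>2 + 4 * (norm c)\<^sup>2)"
      using E by (intro mult_left_mono) auto
    finally show "(norm (exp (2 * u z) *\<^sub>R g z + 2 * (cnj (k z) + (g z)\<^sup>2 / 2) * cnj (g z)))\<^sup>2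
      \<le> 2 * (norm (g z))\<^sup>2 * (4 * exp (2 * u z) * (norm (g z))\<^sup>2 + (exp (2 * u z))\<^sup>2 + 4 * (norm (cnj (k z) + (g z)\<^sup>2 / 2))\<^sup>2)"
      unfolding E_def c_def n_def .
    have "0 \<le> 2 * (u z - m) * exp (2 * u z)" using bound(1)[of z] z by simp
    then show "24 * r\<^sup>2 * (norm (g z))\<^sup>2 \<le> 12 * r\<^sup>2 * (2 * (u z - m) * exp (2 * u z) + 2 * (norm (g z))\<^sup>2)"
      by (simp add: distrib_left)
  next
    fix z assume "z \<in> sphere a r"
    then have z: "z \<in> cball a r" by auto
    have "(u z - m)\<^sup>2 \<le> (M - m)\<^sup>2" using bound[OF z] by (intro power_mono) auto
    then have "12 * r\<^sup>2 * (u z - m)\<^sup>2 \<le> 12 * r\<^sup>2 * (M - m)\<^sup>2" by (intro mult_left_mono) auto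
    moreover have "0 \<le> 12 * r\<^sup>2 * (u a - m)\<^sup>2" by simp
    ultimately show "12 * r\<^sup>2 * (u z - m)\<^sup>2 - 12 * r\<^sup>2 * (u a - m)\<^sup>2 \<le> 12 * r\<^sup>2 * (M - m)\<^sup>2" by linarith
  qed (auto intro!: continuous_intros cont)
  moreover have "r ^ 4 = r\<^sup>2 * r\<^sup>2" by (simp flip: power_add)
  ultimately have "r\<^sup>2 * (r\<^sup>2 * (norm (g a))\<^sup>2) \<le> r\<^sup>2 * (12 * (M - m)\<^sup>2)" by (simp only: mult_ac)
  then have "r\<^sup>2 * (norm (g a))\<^sup>2 \<le> 12 * (M - m)\<^sup>2" by (rule mult_left_le_imp_le) (use r in simp)
  then show ?thesis using r by (simp add: pos_le_divide_eq mult.commute)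
qed

text \<open>Bernstein's method with \<open>Q = \<bar>k\<bar>\<^sup>2\<close>. By \<open>laplacian_gradient_sq\<close>, the Laplacian of \<open>\<bar>g\<bar>\<^sup>2\<close> is at least
\<open>4 \<bar>cnj k + g\<^sup>2/2\<bar>\<^sup>2\<close>, hence at least \<open>2 \<bar>k\<bar>\<^sup>2 - \<bar>g\<bar>\<^sup>4\<close>. So \<open>12 r\<^sup>2 \<bar>g\<bar>\<^sup>2\<close> serves as \<open>W\<close> after the error \<open>\<bar>g\<bar>\<^sup>4 \<le> N \<bar>g\<bar>\<^sup>2\<close>
has been absorbed by a multiple of \<open>(u - m)\<^sup>2\<close>.\<close>
lemma quadratic_differential_estimate:
  assumes sol: "liouville_solution_on u g k S" and r: "r > 0" "cball a r \<subseteq> S"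
    and bound: "\<And>z. z \<in> cball a r \<Longrightarrow> m \<le> u z" "\<And>z. z \<in> cball a r \<Longrightarrow> u z \<le> M"
    and N: "\<And>z. z \<in> cball a r \<Longrightarrow> (norm (g z))\<^sup>2 \<le> N"
  shows "(norm (k a))\<^sup>2 \<le> (12 * N + 6 * N * (M - m)\<^sup>2) / r\<^sup>2"
proof -
  have sub: "ball a r \<subseteq> S" using r by auto
  have N0: "N \<ge> 0" using N[of a] r by (meson centre_in_cball less_imp_le order_trans zero_le_power2)
  note cont = liouville_solution_continuous[OF sol, THEN continuous_on_subset, OF r(2)]
  have hol: "k holomorphic_on ball a r"
    using sol sub by (meson holomorphic_on_subset liouville_solution_on_def)
  define E where "E z = exp (2 * u z)" for z
  define c where "c z = cnj (k z) + (g z)\<^sup>2 / 2" for z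
  have W: "has_laplacian_on (\<lambda>z. (12 * r\<^sup>2) * (norm (g z))\<^sup>2 + (6 * r\<^sup>2 * N) * (u z - m)\<^sup>2)
     (\<lambda>z. (12 * r\<^sup>2) *\<^sub>R (E z *\<^sub>R g z + 2 * c z * cnj (g z)) + (6 * r\<^sup>2 * N) *\<^sub>R ((2 * (u z - m)) *\<^sub>R g z))
     (\<lambda>z. (12 * r\<^sup>2) * (4 * E z * (norm (g z))\<^sup>2 + (E z)\<^sup>2 + 4 * (norm (c z))\<^sup>2)
        + (6 * r\<^sup>2 * N) * (2 * (u z - m) * E z + 2 * (norm (g z))\<^sup>2)) (ball a r)"
    unfolding E_def c_def
    by (intro has_laplacian_on_add has_laplacian_on_cmult laplacian_shifted_sq
        has_laplacian_on_subset[OF liouville_solution_laplacian[OF sol] sub]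
        has_laplacian_on_subset[OF laplacian_gradient_sq[OF sol] sub])
  have "r ^ 4 * (norm (k a))\<^sup>2 \<le> r\<^sup>2 * (12 * N + 6 * N * (M - m)\<^sup>2)"
  proof (rule bernstein_estimate[OF r(1) laplacian_norm_sq_holomorphic[OF hol open_ball] _ W])
    fix z assume z: "z \<in> ball a r"
    show "(norm (2 * k z * cnj (deriv k z)))\<^sup>2 \<le> 2 * (norm (k z))\<^sup>2 * (4 * (norm (deriv k z))\<^sup>2)"
      by (simp add: norm_mult power_mult_distrib)
    define n where "n = (norm (g z))\<^sup>2"
    have n: "0 \<le> n" "n \<le> N" using N[of z] z by (auto simp: n_def)
    have "norm (k z) = norm (c z - (g z)\<^sup>2 / 2)" by (simp add: c_def)
    also have "\<dots> \<le> norm (c z) + norm ((g z)\<^sup>2 / 2)" by (rule norm_triangle_ineq4)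
    also have "norm ((g z)\<^sup>2 / 2) = n / 2" by (simp add: n_def norm_divide norm_power)
    finally have "(norm (k z))\<^sup>2 \<le> (norm (c z) + n / 2)\<^sup>2" by (intro power_mono) auto
    also have "\<dots> = 2 * (norm (c z))\<^sup>2 + n\<^sup>2 / 2 - (norm (c z) - n / 2)\<^sup>2"
      by (simp add: power2_eq_square algebra_simps)
    also have "\<dots> \<le> 2 * (norm (c z))\<^sup>2 + N * n / 2"
      using mult_right_mono[OF n(2,1)] zero_le_power2[of "norm (c z) - n / 2"]
      unfolding power2_eq_square[of n] by linarith
    finally have "2 * (norm (k z))\<^sup>2 \<le> 4 * (norm (c z))\<^sup>2 + N * n" by simp
    then have "12 * r\<^sup>2 * (2 * (norm (k z))\<^sup>2) \<le> 12 * r\<^sup>2 * (4 * (norm (c z))\<^sup>2 + N * n)"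
      by (intro mult_left_mono) auto
    moreover have "0 \<le> 12 * r\<^sup>2 * (4 * E z * n + (E z)\<^sup>2)" using n by (simp add: E_def)
    moreover have "0 \<le> 6 * r\<^sup>2 * N * (2 * (u z - m) * E z)"
      using N0 bound(1)[of z] z by (simp add: E_def)
    ultimately show "24 * r\<^sup>2 * (norm (k z))\<^sup>2 \<le>
        (12 * r\<^sup>2) * (4 * E z * (norm (g z))\<^sup>2 + (E z)\<^sup>2 + 4 * (norm (c z))\<^sup>2)
        + (6 * r\<^sup>2 * N) * (2 * (u z - m) * E z + 2 * (norm (g z))\<^sup>2)"
      unfolding n_def[symmetric] by (simp add: algebra_simps)
  next
    fix z assume "z \<in> sphere a r"
    then have z: "z \<in> cball a r" by auto
    have "(u z - m)\<^sup>2 \<le> (M - m)\<^sup>2" using bound[OF z] by (intro power_mono) auto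
    then have "6 * r\<^sup>2 * N * (u z - m)\<^sup>2 \<le> 6 * r\<^sup>2 * N * (M - m)\<^sup>2" using N0 by (intro mult_left_mono) auto
    moreover have "12 * r\<^sup>2 * (norm (g z))\<^sup>2 \<le> 12 * r\<^sup>2 * N" using N[OF z] by (intro mult_left_mono) auto
    moreover have "0 \<le> 12 * r\<^sup>2 * (norm (g a))\<^sup>2 + 6 * r\<^sup>2 * N * (u a - m)\<^sup>2" using N0 by simp
    ultimately show "12 * r\<^sup>2 * (norm (g z))\<^sup>2 + 6 * r\<^sup>2 * N * (u z - m)\<^sup>2
        - (12 * r\<^sup>2 * (norm (g a))\<^sup>2 + 6 * r\<^sup>2 * N * (u a - m)\<^sup>2) \<le> r\<^sup>2 * (12 * N + 6 * N * (M - m)\<^sup>2)"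
      by (simp add: algebra_simps)
  qed (auto intro!: continuous_intros cont)
  moreover have "r ^ 4 = r\<^sup>2 * r\<^sup>2" by (simp flip: power_add)
  ultimately have "r\<^sup>2 * (r\<^sup>2 * (norm (k a))\<^sup>2) \<le> r\<^sup>2 * (12 * N + 6 * N * (M - m)\<^sup>2)" by (simp only: mult_ac)
  then have "r\<^sup>2 * (norm (k a))\<^sup>2 \<le> 12 * N + 6 * N * (M - m)\<^sup>2" by (rule mult_left_le_imp_le) (use r in simp)
  then show ?thesis using r by (simp add: pos_le_divide_eq mult.commute)
qed

section \<open>Derivatives of pointwise limits\<close>

text \<open>The Lipschitz bound gives \<open>\<bar>f j y - f j x - D j x (y - x)\<bar> \<le> C \<bar>y - x\<bar>\<^sup>2\<close> with \<open>C\<close> independent of \<open>j\<close>. Hence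
\<open>D j x v\<close> is a difference quotient of \<open>f j\<close> up to an error that is small uniformly in \<open>j\<close>, so it is Cauchy in \<open>j\<close>;
and the inequality itself survives the limit, where it expresses differentiability.\<close>
lemma has_derivative_pointwise_limit:
  fixes f :: "nat \<Rightarrow> 'a::euclidean_space \<Rightarrow> 'b::banach"
  assumes U: "convex U" "open U"
    and D: "\<And>j x. x \<in> U \<Longrightarrow> (f j has_derivative D j x) (at x)"
    and K: "\<And>j x y v. x \<in> U \<Longrightarrow> y \<in> U \<Longrightarrow> norm (D j x v - D j y v) \<le> K * norm (x - y) * norm v"
    and F: "\<And>x. x \<in> U \<Longrightarrow> (\<lambda>j. f j x) \<longlonglongrightarrow> F x"
    and x: "x \<in> U"
  shows "(\<lambda>j. D j x v) \<longlonglongrightarrow> lim (\<lambda>j. D j x v)"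
    and "(F has_derivative (\<lambda>v. lim (\<lambda>j. D j x v))) (at x)"
proof -
  define C where "C = max K 1"
  have C: "C > 0" by (simp add: C_def)
  obtain d0 where d0: "d0 > 0" "ball x d0 \<subseteq> U" using U x openE by blast
  have taylor: "norm (f j y - f j x - D j x (y - x)) \<le> C * (norm (y - x))\<^sup>2" if y: "y \<in> U" for j y
  proof -
    have seg: "closed_segment x y \<subseteq> U" using x y U by (simp add: closed_segment_subset)
    have "norm (f j y - f j x - D j x (y - x)) \<le> norm (y - x) * (C * norm (y - x))"
    proof (rule differentiable_bound_linearization[where S = "closed_segment x y" and f' = "D j"])
      show "x + t *\<^sub>R (y - x) \<in> closed_segment x y" if "t \<in> {0..1}" for t
        using that by (auto simp: in_segment algebra_simps intro!: exI[of _ t])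
      show "(f j has_derivative D j z) (at z within closed_segment x y)" if "z \<in> closed_segment x y" for z
        using D[of z j] that seg by (auto intro: has_derivative_at_withinI)
      show "onorm (D j z - D j x) \<le> C * norm (y - x)" if z: "z \<in> closed_segment x y" for z
      proof (rule onorm_le)
        fix v
        have "norm (D j z v - D j x v) \<le> K * norm (z - x) * norm v" using K z seg x by blast
        also have "\<dots> \<le> C * norm (y - x) * norm v"
          using segment_bound1[OF z] C by (intro mult_right_mono mult_mono) (auto simp: C_def)
        finally show "norm ((D j z - D j x) v) \<le> C * norm (y - x) * norm v" by simp
      qed
    qed auto
    then show ?thesis by (simp add: power2_eq_square mult_ac)
  qed
  have lin: "linear (D j x)" for j using D[OF x] by (rule has_derivative_linear)
  have lim: "(\<lambda>j. D j x v) \<longlonglongrightarrow> lim (\<lambda>j. D j x v)" for v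
  proof -
    have "Cauchy (\<lambda>j. D j x v)"
    proof (rule metric_CauchyI)
      fix e :: real assume e: "e > 0"
      define n where "n = norm v + 1"
      have n: "n > 0" "norm v \<le> n" by (auto simp: n_def intro!: add_nonneg_pos)
      \<comment> \<open>The step is short enough to stay in \<open>U\<close> and to make the Taylor error at most a quarter of \<open>t e\<close>.\<close>
      define t where "t = min (d0 / (2 * n)) (e / (4 * C * n\<^sup>2))"
      have t: "t > 0" "t \<le> d0 / (2 * n)" "t \<le> e / (4 * C * n\<^sup>2)"
        using d0 e n C by (auto simp: t_def)
      have "t * norm v \<le> t * n" using t n by (intro mult_left_mono) auto
      also have "\<dots> \<le> d0 / 2" using t(2) n by (simp add: field_simps)
      finally have xt: "x + t *\<^sub>R v \<in> U" using d0 t by (auto simp: subset_iff dist_norm)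
      have small: "C * (norm (t *\<^sub>R v))\<^sup>2 \<le> t * (e / 4)"
      proof -
        have "C * (norm (t *\<^sub>R v))\<^sup>2 \<le> C * (t * n)\<^sup>2"
          using t n C by (intro mult_left_mono power_mono) auto
        also have "\<dots> = t * (t * (C * n\<^sup>2))" by (simp add: power2_eq_square mult_ac)
        also have "\<dots> \<le> t * (e / 4)"
          using t(1,3) n C by (intro mult_left_mono) (auto simp: pos_le_divide_eq mult_ac)
        finally show ?thesis .
      qed
      define q where "q j = f j (x + t *\<^sub>R v) - f j x" for j
      have "Cauchy q" unfolding q_def
        by (rule LIMSEQ_imp_Cauchy[OF tendsto_diff[OF F[OF xt] F[OF x]]])
      then obtain N where N: "\<And>i j. i \<ge> N \<Longrightarrow> j \<ge> N \<Longrightarrow> norm (q i - q j) < t * (e / 2)"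
        using CauchyD[of q "t * (e / 2)"] t e by auto
      have tay: "norm (q j - t *\<^sub>R D j x v) \<le> t * (e / 4)" for j
        using taylor[OF xt, of j] small linear_cmul[OF lin, of j t v] by (simp add: q_def)
      have "dist (D i x v) (D j x v) < e" if ij: "i \<ge> N" "j \<ge> N" for i j
      proof -
        have "t * norm (D i x v - D j x v) = norm (t *\<^sub>R D i x v - t *\<^sub>R D j x v)"
          using t by (simp flip: scaleR_diff_right)
        also have "\<dots> = norm ((q i - q j) - (q i - t *\<^sub>R D i x v) + (q j - t *\<^sub>R D j x v))"
          by (simp add: algebra_simps)
        also have "\<dots> \<le> norm (q i - q j) + norm (q i - t *\<^sub>R D i x v) + norm (q j - t *\<^sub>R D j x v)"
          by (meson add_right_mono norm_triangle_ineq norm_triangle_ineq4 order_trans)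
        also have "\<dots> < t * (e / 2) + t * (e / 4) + t * (e / 4)"
          using N[OF ij] tay by (intro add_less_le_mono) auto
        also have "\<dots> = t * e" by (simp add: field_simps)
        finally show ?thesis using t by (simp add: dist_norm)
      qed
      then show "\<exists>N. \<forall>i\<ge>N. \<forall>j\<ge>N. dist (D i x v) (D j x v) < e" by blast
    qed
    then show ?thesis by (simp add: Cauchy_convergent_iff convergent_LIMSEQ_iff)
  qed
  show "(\<lambda>j. D j x v) \<longlonglongrightarrow> lim (\<lambda>j. D j x v)" by (rule lim)
  define D' where "D' v = lim (\<lambda>j. D j x v)" for v
  have D': "(\<lambda>j. D j x v) \<longlonglongrightarrow> D' v" for v unfolding D'_def by (rule lim)
  have "linear D'"
  proof
    show "D' (v + w) = D' v + D' w" for v w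
      using tendsto_add[OF D'[of v] D'[of w]] D'[of "v + w"] LIMSEQ_unique
      by (simp add: linear_add[OF lin]) blast
    show "D' (c *\<^sub>R v) = c *\<^sub>R D' v" for c v
      using tendsto_scaleR[OF tendsto_const D'[of v], of c] D'[of "c *\<^sub>R v"] LIMSEQ_unique
      by (simp add: linear_cmul[OF lin]) blast
  qed
  have "(F has_derivative D') (at x)"
    unfolding has_derivative_at_alt
  proof (intro conjI allI impI)
    show "bounded_linear D'" using \<open>linear D'\<close> by (simp add: linear_conv_bounded_linear)
    fix e :: real assume e: "e > 0"
    define d where "d = min d0 (e / C)"
    have "d > 0" using d0 e C by (simp add: d_def)
    moreover have "norm (F y - F x - D' (y - x)) \<le> e * norm (y - x)" if y: "norm (y - x) < d" for y
    proof -
      have yU: "y \<in> U" using y d0 by (auto simp: d_def subset_iff dist_norm norm_minus_commute)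
      have "(\<lambda>j. norm (f j y - f j x - D j x (y - x))) \<longlonglongrightarrow> norm (F y - F x - D' (y - x))"
        by (intro tendsto_intros F D' yU x)
      then have "norm (F y - F x - D' (y - x)) \<le> C * (norm (y - x))\<^sup>2"
        by (rule LIMSEQ_le_const2) (use taylor[OF yU] in auto)
      also have "\<dots> = (C * norm (y - x)) * norm (y - x)" by (simp add: power2_eq_square)
      also have "\<dots> \<le> e * norm (y - x)"
        using y C by (intro mult_right_mono) (auto simp: d_def pos_less_divide_eq mult.commute less_imp_le)
      finally show ?thesis .
    qed
    ultimately show "\<exists>d>0. \<forall>y. norm (y - x) < d \<longrightarrow> norm (F y - F x - D' (y - x)) \<le> e * norm (y - x)" by blast
  qed
  then show "(F has_derivative (\<lambda>v. lim (\<lambda>j. D j x v))) (at x)" by (simp add: D'_def[abs_def])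
qed

section \<open>Uniform Lipschitz bounds for gradients and Hessians\<close>

lemma liouville_hessian_bound:
  assumes "0 \<le> E" "E \<le> T" "norm k \<le> P" "norm g \<le> N"
  shows "norm (liouville_hessian E g k h) \<le> (T + P + N\<^sup>2) * norm h"
proof -
  have N: "(norm g)\<^sup>2 \<le> N\<^sup>2" using assms by (intro power_mono) auto
  have "norm (liouville_hessian E g k h) \<le> norm ((E / 2) *\<^sub>R h) + norm ((cnj k + g\<^sup>2 / 2) * cnj h)"
    unfolding liouville_hessian_def by (rule norm_triangle_ineq)
  also have "\<dots> = (E / 2 + norm (cnj k + g\<^sup>2 / 2)) * norm h"
  proof -
    have "norm ((E / 2) *\<^sub>R h) = E / 2 * norm h" using assms by simp
    then show ?thesis unfolding norm_mult complex_mod_cnj by (simp only: distrib_right)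
  qed
  also have "\<dots> \<le> (T + P + N\<^sup>2) * norm h"
  proof (intro mult_right_mono)
    have "norm (cnj k + g\<^sup>2 / 2) \<le> norm k + (norm g)\<^sup>2 / 2"
      by (rule norm_triangle_le) (simp add: norm_divide norm_power)
    then show "E / 2 + norm (cnj k + g\<^sup>2 / 2) \<le> T + P + N\<^sup>2"
      using assms N zero_le_power2[of N] by linarith
  qed auto
  finally show ?thesis .
qed

text \<open>Each bound costs one radius \<open>R\<close>: the lower bound \<open>m\<close> on the disc of radius \<open>5R\<close> gives an upper bound for \<open>u\<close> on
the disc of radius \<open>4R\<close>, then bounds for \<open>g\<close>, \<open>k\<close> and \<open>k'\<close> on the discs of radius \<open>3R\<close>, \<open>2R\<close> and \<open>R\<close>. The bounds
depend on \<open>R\<close> and \<open>m\<close> only, and they control the derivatives of the gradient and of the Hessian.\<close>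
lemma liouville_uniform_lipschitz:
  fixes u :: "'i \<Rightarrow> complex \<Rightarrow> real"
  assumes sol: "\<And>j. liouville_solution_on (u j) (g j) (k j) S"
    and R: "R > 0" and sub: "cball a (5 * R) \<subseteq> S"
    and m: "\<And>j x. x \<in> cball a (5 * R) \<Longrightarrow> m \<le> u j x"
  obtains K where "\<And>j z w h. z \<in> ball a R \<Longrightarrow> w \<in> ball a R \<Longrightarrow>
      u j z \<le> ln (2 / R) \<and> norm (g j z - g j w) \<le> K * norm (z - w) \<and>
      norm (liouville_hessian (exp (2 * u j z)) (g j z) (k j z) h
          - liouville_hessian (exp (2 * u j w)) (g j w) (k j w) h) \<le> K * norm (z - w) * norm h"
proof -
  define M where "M = ln (2 / R)"
  define N where "N = 12 * (M - m)\<^sup>2 / R\<^sup>2"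
  define P where "P = sqrt ((12 * N + 6 * N * (M - m)\<^sup>2) / R\<^sup>2)"
  define T where "T = exp (2 * M)"
  define n where "n = sqrt N"
  define K1 where "K1 = T + P + n\<^sup>2"
  define K2 where "K2 = T * n + P / R + n * K1"
  have N0: "N \<ge> 0" by (simp add: N_def)
  have P0: "P \<ge> 0" using N0 by (simp add: P_def)
  have T0: "T \<ge> 0" by (simp add: T_def)
  have n0: "n \<ge> 0" by (simp add: n_def N0)
  have K1: "K1 \<ge> 0" using T0 P0 by (simp add: K1_def)
  have K2: "K2 \<ge> 0" using T0 P0 R K1 n0 by (simp add: K2_def)
  \<comment> \<open>Proved for a single solution, with constants that were fixed before it.\<close>
  have main: "u z \<le> ln (2 / R) \<and> norm (g z - g w) \<le> max K1 K2 * norm (z - w) \<and>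
      norm (liouville_hessian (exp (2 * u z)) (g z) (k z) h - liouville_hessian (exp (2 * u w)) (g w) (k w) h)
        \<le> max K1 K2 * norm (z - w) * norm h"
    if sol: "liouville_solution_on u g k S" and sub: "cball a (5 * R) \<subseteq> S"
      and m: "\<And>x. x \<in> cball a (5 * R) \<Longrightarrow> m \<le> u x" and z: "z \<in> ball a R" and w: "w \<in> ball a R"
    for u g k S z w h
  proof -
    have shift: "y \<in> cball a (t + R)" if "x \<in> cball a t" "y \<in> cball x R" for x y t
      using that dist_triangle[of a y x] by simp
    have inS: "x \<in> S" if "x \<in> cball a R" for x using that sub R by (auto simp: subset_iff)
    have M: "u x \<le> M" if "x \<in> cball a (4 * R)" for x
      unfolding M_def
    proof (rule ahlfors_upper_bound[OF liouville_solution_laplacian[OF sol] R])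
      show "cball x R \<subseteq> S" using shift[OF that] sub by auto
    qed
    have N: "(norm (g x))\<^sup>2 \<le> N" if "x \<in> cball a (3 * R)" for x
      unfolding N_def
    proof (rule gradient_estimate[OF sol R])
      have "y \<in> cball a (4 * R)" "y \<in> cball a (5 * R)" if "y \<in> cball x R" for y
        using shift[OF \<open>x \<in> cball a (3 * R)\<close> that] R by auto
      then show "cball x R \<subseteq> S" "\<And>y. y \<in> cball x R \<Longrightarrow> m \<le> u y" "\<And>y. y \<in> cball x R \<Longrightarrow> u y \<le> M"
        using sub m M by blast+
    qed
    have "(norm (k x))\<^sup>2 \<le> (12 * N + 6 * N * (M - m)\<^sup>2) / R\<^sup>2" if "x \<in> cball a (2 * R)" for x
    proof (rule quadratic_differential_estimate[OF sol R])
      have "y \<in> cball a (3 * R)" "y \<in> cball a (4 * R)" "y \<in> cball a (5 * R)" if "y \<in> cball x R" for y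
        using shift[OF \<open>x \<in> cball a (2 * R)\<close> that] R by auto
      then show "cball x R \<subseteq> S" "\<And>y. y \<in> cball x R \<Longrightarrow> m \<le> u y" "\<And>y. y \<in> cball x R \<Longrightarrow> u y \<le> M"
        "\<And>y. y \<in> cball x R \<Longrightarrow> (norm (g y))\<^sup>2 \<le> N"
        using sub m M N by blast+
    qed
    then have P: "norm (k x) \<le> P" if "x \<in> cball a (2 * R)" for x
      unfolding P_def using that by (simp add: real_le_rsqrt)
    have dk: "norm (deriv k x) \<le> P / R" if "x \<in> cball a R" for x
    proof -
      have xR: "cball x R \<subseteq> S"
      proof
        fix y assume "y \<in> cball x R"
        then have "y \<in> cball a (5 * R)" using shift[OF that, of y] R by auto
        then show "y \<in> S" using sub by blast
      qed
      then have "k holomorphic_on ball x R" "continuous_on (cball x R) k"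
        using sol liouville_solution_continuous[OF sol] ball_subset_cball
        unfolding liouville_solution_on_def by (meson continuous_on_subset holomorphic_on_subset order_trans)+
      from Cauchy_inequality[OF this R, of P 1] show ?thesis
        using P shift[OF that] by (simp add: dist_norm)
    qed
    define H where "H x = liouville_hessian (exp (2 * u x)) (g x) (k x)" for x
    have b: "exp (2 * u x) \<le> T" "norm (k x) \<le> P" "norm (g x) \<le> n" "norm (deriv k x) \<le> P / R"
      if "x \<in> cball a R" for x
    proof -
      have "x \<in> cball a (4 * R)" "x \<in> cball a (3 * R)" "x \<in> cball a (2 * R)" using that R by auto
      then show "exp (2 * u x) \<le> T" "norm (k x) \<le> P" "norm (g x) \<le> n"
        using M P N by (auto simp: T_def n_def intro: real_le_rsqrt)
    qed (use dk that in auto)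
    have Hb: "norm (H x v) \<le> K1 * norm v" if "x \<in> cball a R" for x v
      unfolding H_def K1_def using b[OF that] by (intro liouville_hessian_bound) auto
    note d = liouville_solutionD[OF sol inS, folded H_def]
    have "norm (g z - g w) \<le> K1 * norm (z - w)"
    proof (rule differentiable_bound[OF convex_ball[of a R]])
      show "(g has_derivative H x) (at x within ball a R)" if "x \<in> ball a R" for x
        using d(2)[of x] that by (auto intro: has_derivative_at_withinI)
      show "onorm (H x) \<le> K1" if "x \<in> ball a R" for x
        using Hb[of x] that by (intro onorm_le) auto
    qed (use z w in auto)
    also have "\<dots> \<le> max K1 K2 * norm (z - w)" by (intro mult_right_mono) auto
    finally have 1: "norm (g z - g w) \<le> max K1 K2 * norm (z - w)" .
    define H' where "H' x v = ((exp (2 * u x) * (v \<bullet> g x)) *\<^sub>R h + (cnj (deriv k x * v) + g x * H x v) * cnj h)" for x v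
    have Hh: "(\<lambda>x. H x h) = (\<lambda>x. (exp (2 * u x) / 2) *\<^sub>R h + (cnj (k x) + (g x)\<^sup>2 / 2) * cnj h)"
      by (simp add: H_def liouville_hessian_def)
    have "norm (H z h - H w h) \<le> (K2 * norm h) * norm (z - w)"
    proof (rule differentiable_bound[OF convex_ball[of a R]])
      fix x assume "x \<in> ball a R"
      then have x: "x \<in> cball a R" by simp
      have "((\<lambda>x. H x h) has_derivative H' x) (at x)"
        unfolding Hh H'_def
        by (auto intro!: derivative_eq_intros d(1-3)[OF x] simp: fun_eq_iff algebra_simps)
      then show "((\<lambda>x. H x h) has_derivative H' x) (at x within ball a R)" by (rule has_derivative_at_withinI)
      show "onorm (H' x) \<le> K2 * norm h"
      proof (rule onorm_le)
        fix v
        have "\<bar>v \<bullet> g x\<bar> \<le> norm v * norm (g x)" by (rule Cauchy_Schwarz_ineq2)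
        also have "\<dots> \<le> n * norm v" using mult_right_mono[OF b(3)[OF x] norm_ge_zero[of v]] by (simp add: mult.commute)
        finally have a1: "exp (2 * u x) * \<bar>v \<bullet> g x\<bar> \<le> T * (n * norm v)"
          using b(1)[OF x] T0 by (intro mult_mono) auto
        have a2: "norm (deriv k x) * norm v \<le> P / R * norm v" using b(4)[OF x] by (intro mult_right_mono) auto
        have a3: "norm (g x) * norm (H x v) \<le> n * (K1 * norm v)"
          using b(3)[OF x] Hb[OF x] n0 by (intro mult_mono) auto
        have "norm (H' x v) \<le> norm ((exp (2 * u x) * (v \<bullet> g x)) *\<^sub>R h) + norm ((cnj (deriv k x * v) + g x * H x v) * cnj h)"
          unfolding H'_def by (rule norm_triangle_ineq)
        also have "\<dots> = (exp (2 * u x) * \<bar>v \<bullet> g x\<bar> + norm (cnj (deriv k x * v) + g x * H x v)) * norm h"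
          unfolding distrib_right[of _ _ "norm h"] norm_mult[of _ "cnj h"] by (simp add: abs_mult)
        also have "\<dots> \<le> (exp (2 * u x) * \<bar>v \<bullet> g x\<bar> + (norm (deriv k x) * norm v + norm (g x) * norm (H x v))) * norm h"
          by (intro mult_right_mono add_left_mono norm_triangle_le) (auto simp: norm_mult)
        also have "\<dots> \<le> (T * (n * norm v) + (P / R * norm v + n * (K1 * norm v))) * norm h"
          by (rule mult_right_mono[OF add_mono[OF a1 add_mono[OF a2 a3]] norm_ge_zero])
        also have "\<dots> = K2 * norm h * norm v" by (simp add: K2_def algebra_simps)
        finally show "norm (H' x v) \<le> K2 * norm h * norm v" .
      qed
    qed (use z w in auto)
    also have "\<dots> \<le> (max K1 K2 * norm h) * norm (z - w)" by (intro mult_right_mono) auto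
    finally have 2: "norm (H z h - H w h) \<le> max K1 K2 * norm (z - w) * norm h" by (simp add: mult_ac)
    have "u z \<le> ln (2 / R)" using M[of z] z R by (simp add: M_def)
    then show ?thesis using 1 2 unfolding H_def by blast
  qed
  show ?thesis using main[OF sol sub m] by (rule that)
qed

section \<open>Monotone sequences of metrics\<close>

lemma liouville_solution_of_metric:
  assumes S: "open S" and reg: "regular_conformal_metric S l"
    and curv: "\<And>z. z \<in> S \<Longrightarrow> curvature l z = -1"
  obtains g k where "liouville_solution_on (\<lambda>z. ln (l z)) g k S"
proof -
  have pos: "l z > 0" if "z \<in> S" for z using reg that by (simp add: regular_conformal_metric_def)
  obtain gl Hl where l: "has_hessian_on l gl Hl S" "continuous_on S gl" "\<And>h. continuous_on S (\<lambda>z. Hl z h)"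
    using has_hessian_on_of_Ck2[OF S, of l] reg unfolding regular_conformal_metric_def by metis
  define H where "H z h = inverse (l z) *\<^sub>R Hl z h + - (inverse (l z))\<^sup>2 *\<^sub>R ((h \<bullet> gl z) *\<^sub>R gl z)" for z h
  have u: "has_hessian_on (\<lambda>z. ln (l z)) (\<lambda>z. inverse (l z) *\<^sub>R gl z) H S"
    unfolding H_def
  proof (rule has_hessian_on_compose[OF l(1), where \<phi>'' = "\<lambda>t. - (inverse t)\<^sup>2"])
    show "DERIV ln (l z) :> inverse (l z)" "DERIV inverse (l z) :> - (inverse (l z))\<^sup>2" if "z \<in> S" for z
      using DERIV_ln[of "l z"] DERIV_inverse[of "l z" UNIV] pos[OF that] by (auto simp: numeral_2_eq_2)
  qed
  have H: "continuous_on S (\<lambda>z. H z h)" for h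
    unfolding H_def using has_hessian_on_continuous(1)[OF l(1)] l(2,3) pos
    by (intro continuous_intros) (auto simp: less_imp_neq[symmetric])
  have "trace_of (H z) = exp (2 * ln (l z))" if z: "z \<in> S" for z
    using Ck2_of_has_hessian_on(2)[OF S u H z] curv[OF z] pos[OF z]
    by (simp add: curvature_def exp_double)
  from liouville_solutionI[OF S u this H] that show ?thesis by blast
qed

text \<open>On a disc around each point, the uniform Lipschitz bounds allow \<open>has_derivative_pointwise_limit\<close> to be applied
to the solutions, which yields the gradient of the limit, and then to their gradients, which yields its Hessian.
The bounds are inherited by the limit and make the Hessian continuous; the trace identity passes to the limit.\<close>
lemma liouville_solutions_monotone_limit:
  assumes sol: "\<And>j. liouville_solution_on (u j) (g j) (k j) S"
    and mono: "\<And>j z. z \<in> S \<Longrightarrow> u j z \<le> u (Suc j) z"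
  obtains U G H where "\<And>z. z \<in> S \<Longrightarrow> (\<lambda>j. u j z) \<longlonglongrightarrow> U z"
    "has_hessian_on U G H S" "\<And>h. continuous_on S (\<lambda>z. H z h)"
    "\<And>z. z \<in> S \<Longrightarrow> trace_of (H z) = exp (2 * U z)"
proof
  define Hs where "Hs j z = liouville_hessian (exp (2 * u j z)) (g j z) (k j z)" for j z
  define U where "U z = lim (\<lambda>j. u j z)" for z
  define G where "G z = lim (\<lambda>j. g j z)" for z
  define H where "H z h = lim (\<lambda>j. Hs j z h)" for z h
  have S: "open S" using sol by (simp add: liouville_solution_on_def)
  have inc: "u i z \<le> u j z" if "z \<in> S" "i \<le> j" for i j z
    using lift_Suc_mono_le[of "\<lambda>j. u j z", OF mono[OF that(1)] that(2)] .
  have local: "\<exists>R>0. \<exists>K. ball a R \<subseteq> S \<and> (\<forall>j. \<forall>z\<in>ball a R. \<forall>w\<in>ball a R. \<forall>h.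
      u j z \<le> ln (2 / R) \<and> norm (g j z - g j w) \<le> K * norm (z - w) \<and>
      norm (Hs j z h - Hs j w h) \<le> K * norm (z - w) * norm h)" if a: "a \<in> S" for a
  proof -
    obtain r where r: "r > 0" "cball a r \<subseteq> S" using S a open_contains_cball by blast
    define R where "R = r / 5"
    have R: "R > 0" "cball a (5 * R) \<subseteq> S" using r by (auto simp: R_def)
    have "continuous_on (cball a (5 * R)) (u 0)"
      using liouville_solution_continuous(1)[OF sol] R(2) by (rule continuous_on_subset)
    then obtain b where b: "b \<in> cball a (5 * R)" "\<And>x. x \<in> cball a (5 * R) \<Longrightarrow> u 0 b \<le> u 0 x"
      using continuous_attains_inf[OF compact_cball, of a "5 * R" "u 0"] R(1) by auto
    have m: "u 0 b \<le> u j x" if "x \<in> cball a (5 * R)" for j x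
      using b(2)[OF that] inc[of x 0 j] that R(2) by force
    obtain K where K: "\<And>j z w h. z \<in> ball a R \<Longrightarrow> w \<in> ball a R \<Longrightarrow>
        u j z \<le> ln (2 / R) \<and> norm (g j z - g j w) \<le> K * norm (z - w) \<and>
        norm (Hs j z h - Hs j w h) \<le> K * norm (z - w) * norm h"
      by (rule liouville_uniform_lipschitz[where u = u and g = g and k = k and S = S and R = R and a = a
            and m = "u 0 b", folded Hs_def])
        (rule sol R | erule m that)+
    have "ball a R \<subseteq> S" using R by (auto simp: subset_iff)
    with K R(1) show ?thesis by blast
  qed
  have U: "(\<lambda>j. u j z) \<longlonglongrightarrow> U z" if z: "z \<in> S" for z
  proof -
    obtain R where R: "R > 0" "\<And>j. u j z \<le> ln (2 / R)" using local[OF z] by (meson centre_in_ball)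
    have "incseq (\<lambda>j. u j z)" using inc[OF z] by (auto simp: incseq_def)
    then show ?thesis unfolding U_def
      using incseq_convergent[of "\<lambda>j. u j z" "ln (2 / R)"] R(2) by (metis limI)
  qed
  then show "\<And>z. z \<in> S \<Longrightarrow> (\<lambda>j. u j z) \<longlonglongrightarrow> U z" .
  have limits: "\<exists>R>0. ball a R \<subseteq> S \<and> (\<exists>K. \<forall>x\<in>ball a R. GDERIV U x :> G x \<and> (G has_derivative H x) (at x)
      \<and> (\<forall>h. (\<lambda>j. Hs j x h) \<longlonglongrightarrow> H x h \<and> (\<forall>y\<in>ball a R. norm (H x h - H y h) \<le> K * norm (x - y) * norm h)))"
    if a: "a \<in> S" for a
  proof -
    obtain R K where R: "R > 0" "ball a R \<subseteq> S"
      and Kg: "\<And>j z w. z \<in> ball a R \<Longrightarrow> w \<in> ball a R \<Longrightarrow> norm (g j z - g j w) \<le> K * norm (z - w)"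
      and KH: "\<And>j z w h. z \<in> ball a R \<Longrightarrow> w \<in> ball a R \<Longrightarrow> norm (Hs j z h - Hs j w h) \<le> K * norm (z - w) * norm h"
      using local[OF a] by metis
    have du: "(u j has_derivative (\<lambda>v. v \<bullet> g j x)) (at x)" and dg: "(g j has_derivative Hs j x) (at x)"
      if "x \<in> ball a R" for j x
      unfolding Hs_def using liouville_solutionD(1,2)[OF sol, of x j] that R(2) by auto
    have Kin: "norm (v \<bullet> g j x - v \<bullet> g j y) \<le> K * norm (x - y) * norm v"
      if "x \<in> ball a R" "y \<in> ball a R" for j x y v
    proof -
      have "norm (v \<bullet> g j x - v \<bullet> g j y) \<le> norm v * norm (g j x - g j y)"
        by (metis Cauchy_Schwarz_ineq2 inner_diff_right real_norm_def)
      also have "\<dots> \<le> norm v * (K * norm (x - y))" using Kg[OF that] by (intro mult_left_mono) auto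
      finally show ?thesis by (simp add: mult_ac)
    qed
    have UR: "(\<lambda>j. u j x) \<longlonglongrightarrow> U x" if "x \<in> ball a R" for x using U R(2) that by blast
    note first = has_derivative_pointwise_limit[of "ball a R" u "\<lambda>j x v. v \<bullet> g j x" K U, OF convex_ball open_ball du Kin UR]
    have gG: "(\<lambda>j. g j x) \<longlonglongrightarrow> G x" if x: "x \<in> ball a R" for x
    proof -
      have "(\<lambda>j. g j x) \<longlonglongrightarrow> Complex (lim (\<lambda>j. 1 \<bullet> g j x)) (lim (\<lambda>j. \<i> \<bullet> g j x))"
        using first(1)[OF _ _ _ _ x, of 1] first(1)[OF _ _ _ _ x, of \<i>] unfolding tendsto_complex_iff
        by (simp add: inner_complex_def)
      then show ?thesis unfolding G_def by (metis limI)
    qed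
    have dU: "GDERIV U x :> G x" if x: "x \<in> ball a R" for x
    proof -
      have "lim (\<lambda>j. v \<bullet> g j x) = v \<bullet> G x" for v
        by (intro limI tendsto_intros gG x)
      then show ?thesis unfolding gderiv_def using first(2)[OF _ _ _ _ x] by simp
    qed
    note second = has_derivative_pointwise_limit[of "ball a R" g Hs K G, OF convex_ball open_ball dg KH gG, folded H_def]
    have HsH: "(\<lambda>j. Hs j x h) \<longlonglongrightarrow> H x h" if "x \<in> ball a R" for x h using second(1) that by blast
    have "norm (H x h - H y h) \<le> K * norm (x - y) * norm h" if "x \<in> ball a R" "y \<in> ball a R" for x y h
      by (rule LIMSEQ_le_const2[OF tendsto_norm[OF tendsto_diff[OF HsH[OF that(1)] HsH[OF that(2)]]]])
        (use KH[OF that] in auto)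
    moreover have "(G has_derivative H x) (at x)" if "x \<in> ball a R" for x
      using second(2) that unfolding H_def[abs_def] by blast
    ultimately show ?thesis using R dU HsH by blast
  qed
  show "has_hessian_on U G H S"
    unfolding has_hessian_on_def using limits by (meson centre_in_ball)
  show "continuous_on S (\<lambda>z. H z h)" for h
  proof -
    have "isCont (\<lambda>z. H z h) a" if a: "a \<in> S" for a
    proof -
      obtain R K where R: "R > 0" "\<And>x y. x \<in> ball a R \<Longrightarrow> y \<in> ball a R \<Longrightarrow> norm (H x h - H y h) \<le> K * norm (x - y) * norm h"
        using limits[OF a] by metis
      have "(\<bar>K\<bar> * norm h)-lipschitz_on (ball a R) (\<lambda>z. H z h)"
      proof (rule lipschitz_onI)
        fix x y assume xy: "x \<in> ball a R" "y \<in> ball a R"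
        have "norm (H x h - H y h) \<le> K * norm (x - y) * norm h" by (rule R(2)[OF xy])
        also have "\<dots> \<le> \<bar>K\<bar> * norm (x - y) * norm h" by (intro mult_right_mono) auto
        finally show "dist (H x h) (H y h) \<le> \<bar>K\<bar> * norm h * dist x y" by (simp add: dist_norm mult_ac)
      qed auto
      then show ?thesis using R(1) lipschitz_on_continuous_on continuous_on_eq_continuous_at
        by (metis centre_in_ball open_ball)
    qed
    then show ?thesis by (rule continuous_at_imp_continuous_on[OF ballI])
  qed
  show "trace_of (H z) = exp (2 * U z)" if z: "z \<in> S" for z
  proof -
    have "(\<lambda>j. Hs j z h) \<longlonglongrightarrow> H z h" for h using limits[OF z] by (meson centre_in_ball)
    then have "(\<lambda>j. trace_of (Hs j z)) \<longlonglongrightarrow> trace_of (H z)"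
      unfolding trace_of_complex by (intro tendsto_intros)
    moreover have "(\<lambda>j. trace_of (Hs j z)) \<longlonglongrightarrow> exp (2 * U z)"
      unfolding Hs_def trace_of_liouville_hessian by (intro tendsto_intros U z)
    ultimately show ?thesis by (rule LIMSEQ_unique)
  qed
qed

theorem lemma4p8:
  fixes G :: "complex set" and l :: "nat \<Rightarrow> complex \<Rightarrow> real"
  assumes "open G" and "connected G" and "G \<noteq> {}"
    and "\<And>j. regular_conformal_metric G (l j)"
    and "\<And>j z. z \<in> G \<Longrightarrow> curvature (l j) z = -1"
    and "\<And>j z. z \<in> G \<Longrightarrow> l j z \<le> l (Suc j) z"
  shows "(\<forall>z\<in>G. convergent (\<lambda>j. l j z)) \<and>
         regular_conformal_metric G (\<lambda>z. lim (\<lambda>j. l j z)) \<and>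
         (\<forall>z\<in>G. curvature (\<lambda>z. lim (\<lambda>j. l j z)) z = -1)"
proof -
  have pos: "l j z > 0" if "z \<in> G" for j z
    using assms(4) that by (simp add: regular_conformal_metric_def)
  have "\<exists>g k. liouville_solution_on (\<lambda>z. ln (l j z)) g k G" for j
    using liouville_solution_of_metric[OF assms(1,4,5)] by blast
  then obtain g k where sol: "\<And>j. liouville_solution_on (\<lambda>z. ln (l j z)) (g j) (k j) G" by metis
  obtain U D H where U: "\<And>z. z \<in> G \<Longrightarrow> (\<lambda>j. ln (l j z)) \<longlonglongrightarrow> U z"
    and hess: "has_hessian_on U D H G" and H: "\<And>h. continuous_on G (\<lambda>z. H z h)"
    and trace: "\<And>z. z \<in> G \<Longrightarrow> trace_of (H z) = exp (2 * U z)"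
  proof (rule liouville_solutions_monotone_limit[OF sol])
    show "ln (l j z) \<le> ln (l (Suc j) z)" if "z \<in> G" for j z
      using pos[OF that] assms(6)[OF that] by simp
  qed (rule that)
  define L where "L z = lim (\<lambda>j. l j z)" for z
  have conv: "(\<lambda>j. l j z) \<longlonglongrightarrow> exp (U z)" if "z \<in> G" for z
    using tendsto_exp[OF U[OF that]] pos[OF that] by simp
  then have L: "L z = exp (U z)" if "z \<in> G" for z unfolding L_def using that by (intro limI)
  have "has_hessian_on (\<lambda>z. exp (U z)) (\<lambda>z. exp (U z) *\<^sub>R D z)
     (\<lambda>z h. exp (U z) *\<^sub>R H z h + exp (U z) *\<^sub>R ((h \<bullet> D z) *\<^sub>R D z)) G"
    by (rule has_hessian_on_compose[OF hess]) auto
  then have "has_hessian_on L (\<lambda>z. exp (U z) *\<^sub>R D z)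
     (\<lambda>z h. exp (U z) *\<^sub>R H z h + exp (U z) *\<^sub>R ((h \<bullet> D z) *\<^sub>R D z)) G"
    by (rule has_hessian_on_eq[OF assms(1)]) (simp add: L)
  then have "Ck_on 2 L G"
    by (rule Ck2_of_has_hessian_on(1)[OF assms(1)])
      (intro continuous_intros has_hessian_on_continuous[OF hess] H)
  then have "regular_conformal_metric G L" by (simp add: regular_conformal_metric_def L)
  moreover have "curvature L z = -1" if z: "z \<in> G" for z
  proof -
    have "has_hessian_on (\<lambda>z. ln (L z)) D H G"
      using has_hessian_on_eq[OF assms(1) hess, of "\<lambda>z. ln (L z)"] L by simp
    then have "laplacian (\<lambda>z. ln (L z)) z = exp (2 * U z)"
      using Ck2_of_has_hessian_on(2)[OF assms(1) _ H z] trace[OF z] by simp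
    then show ?thesis by (simp add: curvature_def L[OF z] exp_double)
  qed
  moreover have "convergent (\<lambda>j. l j z)" if "z \<in> G" for z using conv[OF that] by (rule convergentI)
  ultimately show ?thesis unfolding L_def by blast
qed

end
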